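(* For each integer $N\ge 5$ there is a real number $A_N$ such that for all $A>A_N$ and every $i\in\{1,\dots,\lfloor N/2\rfloor\}$, the eigenvalues $\lambda_{(N,i,\pm)}$ of the Hessian of $f$ at the equal-mass regular polygon satisfy $$\lambda_{(N,i,+)}>0,$$ and $$\lambda_{(N,i,-)}>0\ \text{ for } i<2,\qquad \lambda_{(N,i,-)}<0\ \text{ for } i\ge 2 .$$ Consequently the Morse index of $f$ at the regular polygon on the quotient configuration space $\mathcal{C}_N$ is $N-3$ for all $A>A_N$.
   Context: Let $A>2$ be real. For $N$ bodies of equal masses $m_0=\dots=m_{N-1}=1$ at positions $q_i=(r_i\cos\theta_i,r_i\sin\theta_i)\in\mathbb{R}^2$, $i\in\{0,\dots,N-1\}$, with $r_{i,k}=|q_i-q_k|$, let $$f=\frac{N}{2}\sum_{i=0}^{N-1} r_i^2+\frac{1}{A-2}\sum_{0\le i<k\le N-1} r_{i,k}^{2-A}.$$ The regular polygon is the critical point $r_i=r$, $\theta_i=2\pi i/N$ of $f$, where $u_{0,j}=2\sin(\pi j/N)$ and $r=\left(\frac{1}{2N}\sum_{j=1}^{N-1}u_{0,j}^{2-A}\right)^{1/A}$. In the coordinates $(r_0,\dots,r_{N-1},\theta_0,\dots,\theta_{N-1})$ the Hessian of $f$ at the regular polygon is $\begin{pmatrix} R & W\\ -W& T\end{pmatrix}$ with $R,T$ circulant symmetric and $W$ circulant antisymmetric $N\times N$ matrices, where $R_{i,j}=\partial^2 f/\partial r_i\partial r_j$, $W_{i,j}=\partial^2 f/\partial r_i\partial\theta_j$,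 $T_{i,j}=\partial^2 f/\partial\theta_i\partial\theta_j$. For $0\le i\le N-1$ put $$P_{i,i}=\sum_{j=0}^{N-1}R_{0,j}e^{2\pi \sqrt{-1}\, ij/N},\quad Q_{i,i}=\sum_{j=0}^{N-1}T_{0,j}e^{2\pi \sqrt{-1}\, ij/N},\quad S_{i,i}=\sum_{j=0}^{N-1}W_{0,j}e^{2\pi \sqrt{-1}\, ij/N}$$ ($P_{i,i},Q_{i,i}$ are real and $S_{i,i}$ is purely imaginary). The Hessian is block-diagonalized into the $2\times2$ blocks $\begin{pmatrix}P_{i,i}&S_{i,i}\\-S_{i,i}&Q_{i,i}\end{pmatrix}$, whose eigenvalues are $$\lambda_{(N,i,\pm)}=\tfrac12\left(P_{i,i}+Q_{i,i}\pm\sqrt{(P_{i,i}-Q_{i,i})^2-4S_{i,i}^2}\right).$$ The configuration space is $\mathcal{C}_N=(\mathbb{R}^{2N}\setminus\Delta)/S^1$, where $\Delta$ is the set of configurations with $q_i=q_j$ for some $i\neq j$ and $S^1$ acts by simultaneous rotation about the origin; $f$ descends to $\mathcal{C}_N$. The Morse index of a critical point is the maximal dimension of a subspace of the tangent space on which the Hessian of $f$ (on $\mathcal{C}_N$) is negative definite. *)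

theory Defs
  imports "HOL-Analysis.Analysis" "HOL-Library.Function_Algebras"
begin

text \<open>
  The plane is identified with \<^typ>\<open>complex\<close>. A configuration of \<open>N\<close> bodies is a function
  \<^typ>\<open>nat \<Rightarrow> complex\<close> vanishing at all indices \<open>\<ge> N\<close>, so that \<open>\<real>\<^sup>2\<^sup>N\<close> becomes a subspace of the
  real vector space \<^typ>\<open>nat \<Rightarrow> complex\<close> (with pointwise operations) and the library notions
  \<^term>\<open>subspace\<close> and \<^term>\<open>dim\<close> apply.
\<close>

instantiation "fun" :: (type, real_vector) real_vector
begin

definition "scaleR_fun c f = (\<lambda>x. c *\<^sub>R f x)"

instance
  by standard (simp_all add: scaleR_fun_def fun_eq_iff scaleR_add_right scaleR_add_left)

end

definition configs :: "nat \<Rightarrow> (nat \<Rightarrow> complex) set" where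
  "configs N = {q. \<forall>i\<ge>N. q i = 0}"

definition collisions :: "nat \<Rightarrow> (nat \<Rightarrow> complex) set" where
  "collisions N = {q \<in> configs N. \<exists>i<N. \<exists>j<N. i \<noteq> j \<and> q i = q j}"

definition energy :: "nat \<Rightarrow> real \<Rightarrow> (nat \<Rightarrow> complex) \<Rightarrow> real" where
  "energy N A q =
     real N / 2 * (\<Sum>i<N. (cmod (q i))\<^sup>2)
     + 1 / (A - 2) * (\<Sum>k<N. \<Sum>i<k. (dist (q i) (q k)) powr (2 - A))"


subsection \<open>Polar coordinates and the regular polygon\<close>

definition from_polar :: "nat \<Rightarrow> (nat \<Rightarrow> real) \<Rightarrow> (nat \<Rightarrow> real) \<Rightarrow> nat \<Rightarrow> complex" where
  "from_polar N r \<theta> = (\<lambda>i. if i < N then rcis (r i) (\<theta> i) else 0)"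

definition energy_polar :: "nat \<Rightarrow> real \<Rightarrow> (nat \<Rightarrow> real) \<Rightarrow> (nat \<Rightarrow> real) \<Rightarrow> real" where
  "energy_polar N A r \<theta> = energy N A (from_polar N r \<theta>)"

definition polygon_radius :: "nat \<Rightarrow> real \<Rightarrow> real" where
  "polygon_radius N A =
     (1 / (2 * real N) * (\<Sum>j=1..<N. (2 * sin (pi * real j / real N)) powr (2 - A))) powr (1 / A)"

definition polygon_radii :: "nat \<Rightarrow> real \<Rightarrow> nat \<Rightarrow> real" where
  "polygon_radii N A = (\<lambda>i. polygon_radius N A)"

definition polygon_angles :: "nat \<Rightarrow> nat \<Rightarrow> real" where
  "polygon_angles N = (\<lambda>i. 2 * pi * real i / real N)"

definition regular_polygon :: "nat \<Rightarrow> real \<Rightarrow> nat \<Rightarrow> complex" where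
  "regular_polygon N A = from_polar N (polygon_radii N A) (polygon_angles N)"


subsection \<open>The Hessian in polar coordinates and its eigenvalues\<close>

definition partial_r ::
    "nat \<Rightarrow> ((nat \<Rightarrow> real) \<Rightarrow> (nat \<Rightarrow> real) \<Rightarrow> real) \<Rightarrow> (nat \<Rightarrow> real) \<Rightarrow> (nat \<Rightarrow> real) \<Rightarrow> real" where
  "partial_r i F = (\<lambda>r \<theta>. deriv (\<lambda>x. F (r(i := x)) \<theta>) (r i))"

definition partial_\<theta> ::
    "nat \<Rightarrow> ((nat \<Rightarrow> real) \<Rightarrow> (nat \<Rightarrow> real) \<Rightarrow> real) \<Rightarrow> (nat \<Rightarrow> real) \<Rightarrow> (nat \<Rightarrow> real) \<Rightarrow> real" where
  "partial_\<theta> i F = (\<lambda>r \<theta>. deriv (\<lambda>x. F r (\<theta>(i := x))) (\<theta> i))"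

definition hess_R :: "nat \<Rightarrow> real \<Rightarrow> nat \<Rightarrow> nat \<Rightarrow> real" where
  "hess_R N A i j =
     partial_r i (partial_r j (energy_polar N A)) (polygon_radii N A) (polygon_angles N)"

definition hess_W :: "nat \<Rightarrow> real \<Rightarrow> nat \<Rightarrow> nat \<Rightarrow> real" where
  "hess_W N A i j =
     partial_r i (partial_\<theta> j (energy_polar N A)) (polygon_radii N A) (polygon_angles N)"

definition hess_T :: "nat \<Rightarrow> real \<Rightarrow> nat \<Rightarrow> nat \<Rightarrow> real" where
  "hess_T N A i j =
     partial_\<theta> i (partial_\<theta> j (energy_polar N A)) (polygon_radii N A) (polygon_angles N)"

definition circulant_eigenvalue :: "nat \<Rightarrow> (nat \<Rightarrow> nat \<Rightarrow> real) \<Rightarrow> nat \<Rightarrow> complex" where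
  "circulant_eigenvalue N M i =
     (\<Sum>j<N. complex_of_real (M 0 j) * exp (2 * of_real pi * \<i> * of_nat i * of_nat j / of_nat N))"

definition P_diag :: "nat \<Rightarrow> real \<Rightarrow> nat \<Rightarrow> complex" where
  "P_diag N A = circulant_eigenvalue N (hess_R N A)"

definition Q_diag :: "nat \<Rightarrow> real \<Rightarrow> nat \<Rightarrow> complex" where
  "Q_diag N A = circulant_eigenvalue N (hess_T N A)"

definition S_diag :: "nat \<Rightarrow> real \<Rightarrow> nat \<Rightarrow> complex" where
  "S_diag N A = circulant_eigenvalue N (hess_W N A)"

text \<open>
  \<open>P\<close> and \<open>Q\<close> are real and \<open>S\<close> is purely imaginary, so the radicand is a nonnegative real and
  \<^const>\<open>csqrt\<close> is its nonnegative square root. The eigenvalues are kept complex-valued; an assertion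
  about their sign has to include that they are real.
\<close>

definition eigenvalue_plus :: "nat \<Rightarrow> real \<Rightarrow> nat \<Rightarrow> complex" where
  "eigenvalue_plus N A i =
     (P_diag N A i + Q_diag N A i
       + csqrt ((P_diag N A i - Q_diag N A i)\<^sup>2 - 4 * (S_diag N A i)\<^sup>2)) / 2"

definition eigenvalue_minus :: "nat \<Rightarrow> real \<Rightarrow> nat \<Rightarrow> complex" where
  "eigenvalue_minus N A i =
     (P_diag N A i + Q_diag N A i
       - csqrt ((P_diag N A i - Q_diag N A i)\<^sup>2 - 4 * (S_diag N A i)\<^sup>2)) / 2"

definition real_positive :: "complex \<Rightarrow> bool" where
  "real_positive z \<longleftrightarrow> z \<in> \<real> \<and> 0 < Re z"

definition real_negative :: "complex \<Rightarrow> bool" where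
  "real_negative z \<longleftrightarrow> z \<in> \<real> \<and> Re z < 0"


subsection \<open>The quotient configuration space and the Morse index\<close>

definition rotate_config :: "real \<Rightarrow> (nat \<Rightarrow> complex) \<Rightarrow> nat \<Rightarrow> complex" where
  "rotate_config \<phi> q = (\<lambda>i. cis \<phi> * q i)"

definition orbit :: "(nat \<Rightarrow> complex) \<Rightarrow> (nat \<Rightarrow> complex) set" where
  "orbit q = range (\<lambda>\<phi>. rotate_config \<phi> q)"

definition config_space :: "nat \<Rightarrow> (nat \<Rightarrow> complex) set set" where
  "config_space N = orbit ` (configs N - collisions N)"

definition energy_quot :: "nat \<Rightarrow> real \<Rightarrow> (nat \<Rightarrow> complex) set \<Rightarrow> real" where
  "energy_quot N A X = the_elem (energy N A ` X)"

text \<open>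
  The tangent space of the quotient at the class of \<open>q\<close> is \<^term>\<open>configs N\<close> modulo the tangent line
  to the orbit. Since \<open>d/d\<phi> cis \<phi> = \<i>\<close> at \<open>\<phi> = 0\<close>, that line is spanned by \<open>\<i> q\<close>.
\<close>

definition orbit_tangent :: "(nat \<Rightarrow> complex) \<Rightarrow> (nat \<Rightarrow> complex) set" where
  "orbit_tangent q = span {\<lambda>i. \<i> * q i}"

text \<open>
  The Hessian of the descended function, evaluated on the tangent vectors of the quotient represented
  by \<open>v\<close> and \<open>w\<close>. If \<open>q\<close> is a critical point, the value depends only on the classes of \<open>v\<close> and \<open>w\<close>
  modulo \<^term>\<open>orbit_tangent q\<close>.
\<close>

definition hessian_quot ::
    "nat \<Rightarrow> real \<Rightarrow> (nat \<Rightarrow> complex) \<Rightarrow> (nat \<Rightarrow> complex) \<Rightarrow> (nat \<Rightarrow> complex) \<Rightarrow> real" where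
  "hessian_quot N A q v w =
     deriv (\<lambda>s. deriv (\<lambda>t. energy_quot N A (orbit (q + s *\<^sub>R v + t *\<^sub>R w))) 0) 0"

text \<open>
  A subspace of the quotient tangent space is \<open>U / orbit_tangent q\<close> for a unique subspace \<open>U\<close> between
  \<^term>\<open>orbit_tangent q\<close> and \<^term>\<open>configs N\<close>; its nonzero elements are the classes of the
  \<open>v \<in> U - orbit_tangent q\<close>. The dimensions below are bounded by \<open>2 N\<close>, so the maximum exists.
\<close>

definition negative_definite_on ::
    "nat \<Rightarrow> real \<Rightarrow> (nat \<Rightarrow> complex) \<Rightarrow> (nat \<Rightarrow> complex) set \<Rightarrow> bool" where
  "negative_definite_on N A q U \<longleftrightarrow> (\<forall>v \<in> U - orbit_tangent q. hessian_quot N A q v v < 0)"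

definition morse_index_quot :: "nat \<Rightarrow> real \<Rightarrow> (nat \<Rightarrow> complex) \<Rightarrow> nat" where
  "morse_index_quot N A q =
     Max {dim U - dim (orbit_tangent q) | U.
            subspace U \<and> orbit_tangent q \<subseteq> U \<and> U \<subseteq> configs N \<and> negative_definite_on N A q U}"


subsection \<open>Sanity checks\<close>

lemma energy_rotate_config: "energy N A (rotate_config \<phi> q) = energy N A q"
proof -
  have "dist (cis \<phi> * x) (cis \<phi> * y) = dist x y" for x y
    by (metis dist_norm mult.left_neutral norm_cis norm_mult right_diff_distrib)
  then show ?thesis
    by (simp add: energy_def rotate_config_def norm_mult)
qed

lemma energy_quot_orbit: "energy_quot N A (orbit q) = energy N A q"
proof -
  have "energy N A ` orbit q = {energy N A q}"
    by (auto simp: orbit_def energy_rotate_config image_image)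
  then show ?thesis
    by (simp add: energy_quot_def)
qed

lemma polygon_radius_pos:
  assumes "N \<ge> 2"
  shows "polygon_radius N A > 0"
proof -
  have "sin (pi * real j / real N) > 0" if "j \<in> {1..<N}" for j
    using that assms by (intro sin_gt_zero) (auto simp: field_simps)
  then have "(\<Sum>j=1..<N. (2 * sin (pi * real j / real N)) powr (2 - A)) > 0"
    using assms by (intro sum_pos) (force simp: powr_gt_zero)+
  then have "1 / (2 * real N) * (\<Sum>j=1..<N. (2 * sin (pi * real j / real N)) powr (2 - A)) \<noteq> 0"
    using assms by simp
  then show ?thesis
    unfolding polygon_radius_def by (metis powr_gt_zero)
qed

lemma regular_polygon_in_config_space:
  assumes "N \<ge> 2"
  shows "orbit (regular_polygon N A) \<in> config_space N"
proof -
  have "inj_on (\<lambda>k. cis (2 * pi * real k / real N)) {..<N}"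
    using Complex.bij_betw_roots_unity[of N] assms by (auto simp: bij_betw_def)
  then have "regular_polygon N A \<in> configs N - collisions N"
    using polygon_radius_pos[OF assms, of A]
    by (auto simp: configs_def collisions_def regular_polygon_def from_polar_def rcis_def
          polygon_radii_def polygon_angles_def inj_on_def)
  then show ?thesis
    by (simp add: config_space_def)
qed

end

theory Submission
  imports Defs "HOL-Real_Asymp.Real_Asymp"
begin

text \<open>
  At a critical point the Hessian does not depend on the coordinates, so the polar blocks and the
  Cartesian Hessian reduce to the same binary quadratic forms, one for each Fourier mode \<open>m\<close> of the
  polygon. For large \<open>A\<close> only the interaction of neighbouring bodies survives: with
  \<open>b = sin\<^sup>2 (\<pi> / N)\<close> and \<open>s = sin\<^sup>2 (\<pi> m / N)\<close>, the determinant of the \<open>m\<close>-th form is asymptotic to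
  \<open>(N / b)\<^sup>2 s (3 b - 2 b\<^sup>2 - s) A\<close>. This is positive for \<open>m = 1\<close>, where \<open>s = b\<close>. For \<open>2 \<le> m \<le> N - 2\<close> it is
  negative, since then \<open>s \<ge> 4 b (1 - b) > 3 b - 2 b\<^sup>2\<close>, the last step being \<open>b < 1 / 2\<close>, that is \<open>N \<ge> 5\<close>.
  The tangential coefficient of the form is positive for \<open>m \<noteq> 0\<close>, and the mode \<open>m = 0\<close> contributes one
  positive direction and the rotation. Counting negative modes gives the index \<open>N - 3\<close>.
\<close>

subsection \<open>Derivatives of the energy along curves\<close>

text \<open>Cartesian and polar second derivatives come from one chain rule: differentiating
  \<open>energy_grad\<close> along a moving point and a moving direction gives
  \<open>energy_hess\<close> plus \<open>energy_grad\<close> applied to the acceleration. Polar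
  curves do accelerate, so the equation for the radius is needed to discard that term. The same
  equation governs the limit: the radius depends on A in an opaque way, but radial balance fixes the
  total size of the weights, and the weight of a diagonal divided by that of a side decays
  exponentially. The obstacle is that neighbours alone give, to leading order in A, a form of rank
  one: stiffness acts only along a bond, so each mode sees the square of a single linear form. The
  determinant thus has no A^2 term, and its sign is decided one order lower, where the harmonic term
  and the response across the bonds enter. Diagonals still do not interfere there, since A times an
  exponentially small weight tends to 0.\<close>

definition collision_free :: "nat \<Rightarrow> (nat \<Rightarrow> complex) \<Rightarrow> bool" where
  "collision_free N z \<longleftrightarrow> (\<forall>k<N. \<forall>i<k. z i \<noteq> z k)"

definition energy_grad :: "nat \<Rightarrow> real \<Rightarrow> (nat \<Rightarrow> complex) \<Rightarrow> (nat \<Rightarrow> complex) \<Rightarrow> real" where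
  "energy_grad N A z v =
     real N * (\<Sum>i<N. z i \<bullet> v i)
     - (\<Sum>k<N. \<Sum>i<k. norm (z i - z k) powr (- A) * ((z i - z k) \<bullet> (v i - v k)))"

text \<open>The second differential of |d|^(2 - A) / (A - 2) at the separation vector
  \<open>d\<close>, as a bilinear form in \<open>u\<close> and \<open>v\<close>.\<close>

definition pair_hess :: "real \<Rightarrow> complex \<Rightarrow> complex \<Rightarrow> complex \<Rightarrow> real" where
  "pair_hess A d u v =
     A * norm d powr (- A - 2) * (d \<bullet> u) * (d \<bullet> v) - norm d powr (- A) * (u \<bullet> v)"

definition energy_hess ::
    "nat \<Rightarrow> real \<Rightarrow> (nat \<Rightarrow> complex) \<Rightarrow> (nat \<Rightarrow> complex) \<Rightarrow> (nat \<Rightarrow> complex) \<Rightarrow> real" where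
  "energy_hess N A z u v =
     real N * (\<Sum>i<N. u i \<bullet> v i)
     + (\<Sum>k<N. \<Sum>i<k. pair_hess A (z i - z k) (u i - u k) (v i - v k))"

lemma has_real_derivative_inner_curves:
  fixes f g :: "real \<Rightarrow> complex"
  assumes "(f has_vector_derivative f') (at x)" "(g has_vector_derivative g') (at x)"
  shows "((\<lambda>t. f t \<bullet> g t) has_real_derivative f x \<bullet> g' + f' \<bullet> g x) (at x)"
  using bounded_bilinear.has_vector_derivative[OF bounded_bilinear_inner assms]
  by (simp add: has_real_derivative_iff_has_vector_derivative)

text \<open>Powers of the norm become powers of a bilinear expression, so the product rule and
  \<open>DERIV_fun_powr\<close> suffice for their derivatives.\<close>

lemma norm_powr_eq_inner: "norm z powr p = (z \<bullet> z) powr (p / 2)" for z :: complex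
  by (simp add: norm_eq_sqrt_inner powr_half_sqrt[symmetric] powr_powr)

lemma has_real_derivative_norm_powr:
  fixes f :: "real \<Rightarrow> complex"
  assumes f: "(f has_vector_derivative f') (at x)" and "f x \<noteq> 0"
  shows "((\<lambda>t. norm (f t) powr p) has_real_derivative p * norm (f x) powr (p - 2) * (f x \<bullet> f')) (at x)"
proof -
  have "((\<lambda>t. f t \<bullet> f t) has_real_derivative 2 * (f x \<bullet> f')) (at x)"
    using has_real_derivative_inner_curves[OF f f] by (simp add: inner_commute)
  from DERIV_fun_powr[OF this, of "p / 2"] assms(2)
  have "((\<lambda>t. norm (f t) powr p) has_real_derivative
      p / 2 * (f x \<bullet> f x) powr (p / 2 - 1) * (2 * (f x \<bullet> f'))) (at x)"
    by (simp add: norm_powr_eq_inner)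
  moreover have "norm (f x) powr (p - 2) = (f x \<bullet> f x) powr (p / 2 - 1)"
    by (simp add: norm_powr_eq_inner diff_divide_distrib)
  ultimately show ?thesis
    by (simp add: mult_ac)
qed

lemma energy_has_derivative:
  assumes "A > 2"
    and z: "\<And>i. i < N \<Longrightarrow> ((\<lambda>t. z t i) has_vector_derivative v i) (at x)"
    and "collision_free N (z x)"
  shows "((\<lambda>t. energy N A (z t)) has_real_derivative energy_grad N A (z x) v) (at x)"
proof -
  have sq: "((\<lambda>t. (cmod (z t i))\<^sup>2) has_real_derivative 2 * (z x i \<bullet> v i)) (at x)" if "i < N" for i
    using has_real_derivative_inner_curves[OF z z, OF that that]
    by (simp add: inner_commute power2_norm_eq_inner)
  have pair: "((\<lambda>t. dist (z t i) (z t k) powr (2 - A)) has_real_derivative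
      (2 - A) * (norm (z x i - z x k) powr (- A) * ((z x i - z x k) \<bullet> (v i - v k)))) (at x)"
    if "k < N" "i < k" for i k
    using has_real_derivative_norm_powr[OF has_vector_derivative_diff[OF z z], of i k "2 - A"] that assms(3)
    by (simp add: dist_norm collision_free_def mult.assoc)
  have "((\<lambda>t. energy N A (z t)) has_real_derivative
     real N / 2 * (\<Sum>i<N. 2 * (z x i \<bullet> v i)) + 1 / (A - 2) *
       (\<Sum>k<N. \<Sum>i<k. (2 - A) * (norm (z x i - z x k) powr (- A) * ((z x i - z x k) \<bullet> (v i - v k))))) (at x)"
    unfolding energy_def
    by (intro DERIV_add DERIV_cmult DERIV_sum sq pair) auto
  moreover have "1 / (A - 2) * (\<Sum>k<N. \<Sum>i<k. (2 - A) * f i k) = - (\<Sum>k<N. \<Sum>i<k. f i k)" for f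
    unfolding sum_distrib_left[symmetric] using \<open>A > 2\<close> by (simp add: field_simps)
  ultimately show ?thesis
    by (simp add: energy_grad_def sum_distrib_left[symmetric])
qed

text \<open>Point and direction both move. The term \<open>energy_grad N A (z x) w\<close> is what a
  turning direction adds to the Hessian; it matters for polar coordinates, where the direction of an
  angular derivative varies with the point.\<close>

lemma energy_grad_has_derivative:
  assumes z: "\<And>i. i < N \<Longrightarrow> ((\<lambda>t. z t i) has_vector_derivative u i) (at x)"
    and v: "\<And>i. i < N \<Longrightarrow> ((\<lambda>t. v t i) has_vector_derivative w i) (at x)"
    and "collision_free N (z x)"
  shows "((\<lambda>t. energy_grad N A (z t) (v t)) has_real_derivative
           energy_hess N A (z x) u (v x) + energy_grad N A (z x) w) (at x)"
proof -
  have pair: "((\<lambda>t. norm (z t i - z t k) powr (- A) * ((z t i - z t k) \<bullet> (v t i - v t k)))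
      has_real_derivative
      norm (z x i - z x k) powr (- A) * ((z x i - z x k) \<bullet> (w i - w k))
      - pair_hess A (z x i - z x k) (u i - u k) (v x i - v x k)) (at x)"
    if "k < N" "i < k" for i k
  proof -
    have ik: "i < N" "k < N" "z x i - z x k \<noteq> 0"
      using that assms(3) by (auto simp: collision_free_def)
    note dz = has_vector_derivative_diff[OF z z, OF ik(1,2)]
    note dv = has_vector_derivative_diff[OF v v, OF ik(1,2)]
    show ?thesis
      using DERIV_mult[OF has_real_derivative_norm_powr[OF dz ik(3), of "- A"]
          has_real_derivative_inner_curves[OF dz dv]]
      by (simp add: pair_hess_def algebra_simps inner_commute)
  qed
  have "((\<lambda>t. energy_grad N A (z t) (v t)) has_real_derivative
      real N * (\<Sum>i<N. z x i \<bullet> w i + u i \<bullet> v x i)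
      - (\<Sum>k<N. \<Sum>i<k. norm (z x i - z x k) powr (- A) * ((z x i - z x k) \<bullet> (w i - w k))
      - pair_hess A (z x i - z x k) (u i - u k) (v x i - v x k))) (at x)"
    unfolding energy_grad_def
    by (intro DERIV_diff DERIV_cmult DERIV_sum pair has_real_derivative_inner_curves z v) auto
  then show ?thesis
    by (simp add: energy_grad_def energy_hess_def sum.distrib sum_subtractf algebra_simps)
qed

lemma eventually_collision_free:
  assumes "\<And>i. i < N \<Longrightarrow> isCont (\<lambda>t. z t i) x" and "collision_free N (z x)"
  shows "\<forall>\<^sub>F t in nhds x. collision_free N (z t)"
proof -
  have lim: "((\<lambda>t. z t i) \<longlongrightarrow> z x i) (nhds x)" if "i < N" for i
    using assms(1)[OF that] tendsto_at_iff_tendsto_nhds[of "\<lambda>t. z t i" x] by (simp add: isCont_def)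
  have "\<forall>\<^sub>F t in nhds x. z t i \<noteq> z t k" if "k < N" "i < k" for i k
  proof -
    have "((\<lambda>t. z t i - z t k) \<longlongrightarrow> z x i - z x k) (nhds x)"
      using that by (intro tendsto_diff lim) auto
    moreover have "z x i - z x k \<noteq> 0"
      using that assms(2) by (auto simp: collision_free_def)
    ultimately show ?thesis
      by (auto dest!: tendsto_imp_eventually_ne elim!: eventually_mono)
  qed
  then have "\<forall>\<^sub>F t in nhds x. \<forall>k\<in>{..<N}. \<forall>i\<in>{..<k}. z t i \<noteq> z t k"
    by (simp add: eventually_ball_finite_distrib)
  then show ?thesis
    by (auto simp: collision_free_def elim!: eventually_mono)
qed

text \<open>Made for iterated \<open>deriv\<close>: \<open>D\<close> is an inner derivative whose
  value is known only at collision-free configurations. This condition is open along the curve, and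
  \<open>deriv\<close> depends only on values near \<open>x\<close>.\<close>

lemma deriv_energy_grad_eq:
  assumes z: "\<And>i. i < N \<Longrightarrow> ((\<lambda>t. z t i) has_vector_derivative u i) (at x)"
    and v: "\<And>i. i < N \<Longrightarrow> ((\<lambda>t. v t i) has_vector_derivative w i) (at x)"
    and cf: "collision_free N (z x)"
    and D: "\<And>t. collision_free N (z t) \<Longrightarrow> D t = energy_grad N A (z t) (v t)"
  shows "deriv D x = energy_hess N A (z x) u (v x) + energy_grad N A (z x) w"
proof -
  have "\<forall>\<^sub>F t in nhds x. collision_free N (z t)"
    by (intro eventually_collision_free cf has_vector_derivative_continuous[OF z])
  then have "\<forall>\<^sub>F t in nhds x. D t = energy_grad N A (z t) (v t)"
    by (rule eventually_mono) (rule D)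
  then have "deriv D x = deriv (\<lambda>t. energy_grad N A (z t) (v t)) x"
    by (rule deriv_cong_ev) simp
  also have "\<dots> = energy_hess N A (z x) u (v x) + energy_grad N A (z x) w"
    by (intro DERIV_imp_deriv energy_grad_has_derivative z v cf)
  finally show ?thesis .
qed

text \<open>Straight lines have constant direction, so the gradient term is taken at the zero
  vector; rotation invariance lets the energy of an orbit be read off at any representative.\<close>

lemma hessian_quot_eq_energy_hess:
  assumes "A > 2" "collision_free N q"
  shows "hessian_quot N A q v v = energy_hess N A q v v"
proof -
  have line: "((\<lambda>t. (q + s *\<^sub>R v + t *\<^sub>R v) i) has_vector_derivative v i) (at t)" for i s t
    by (auto simp: scaleR_fun_def intro!: derivative_eq_intros)
  have "deriv (\<lambda>s. deriv (\<lambda>t. energy N A (q + s *\<^sub>R v + t *\<^sub>R v)) 0) 0 =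
      energy_hess N A (q + 0 *\<^sub>R v) v v + energy_grad N A (q + 0 *\<^sub>R v) (\<lambda>_. 0)"
  proof (rule deriv_energy_grad_eq)
    show "((\<lambda>t. (q + t *\<^sub>R v) i) has_vector_derivative v i) (at 0)" for i
      by (auto simp: scaleR_fun_def intro!: derivative_eq_intros)
    show "((\<lambda>t. v i) has_vector_derivative 0) (at 0)" for i
      by simp
    show "collision_free N (q + 0 *\<^sub>R v)"
      using assms(2) by simp
    show "deriv (\<lambda>t. energy N A (q + s *\<^sub>R v + t *\<^sub>R v)) 0 = energy_grad N A (q + s *\<^sub>R v) v"
      if "collision_free N (q + s *\<^sub>R v)" for s
      using energy_has_derivative[where z = "\<lambda>t. q + s *\<^sub>R v + t *\<^sub>R v" and x = 0, OF assms(1) line] that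
      by (auto intro: DERIV_imp_deriv)
  qed
  then show ?thesis
    by (simp add: hessian_quot_def energy_quot_orbit energy_grad_def)
qed

subsection \<open>Hartley modes\<close>

text \<open>A geometric sum of powers of an N-th root of unity other than 1. The frequency is an
  integer because differences of mode indices may be negative.\<close>

lemma sum_cis_arith_progression:
  fixes d :: int
  assumes "N > 0" "\<not> int N dvd d"
  shows "(\<Sum>i<N. cis (2 * pi * of_int d * real i / real N + \<psi>)) = 0"
proof -
  define w where "w = cis (2 * pi * of_int d / real N)"
  have "w \<noteq> 1"
  proof
    assume "w = 1"
    then have "cos (2 * pi * of_int d / real N) = 1"
      by (metis w_def cis.sel(1) one_complex.sel(1))
    then obtain n :: int where "2 * pi * of_int d / real N = of_int n * 2 * pi"
      by (auto simp: cos_one_2pi_int)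
    then have "real_of_int d = of_int n * real N"
      using \<open>N > 0\<close> by (simp add: field_simps)
    then have "d = n * int N"
      by (metis of_int_eq_iff of_int_mult of_int_of_nat_eq)
    with assms show False by simp
  qed
  moreover have "w ^ N = 1"
  proof -
    have "w ^ N = cis (2 * pi * of_int d)"
      unfolding w_def Complex.DeMoivre by (rule arg_cong[where f = cis]) (use \<open>N > 0\<close> in simp)
    then show ?thesis by simp
  qed
  ultimately have "(\<Sum>i<N. w ^ i) = 0"
    by (simp add: geometric_sum)
  moreover have "cis (2 * pi * of_int d * real i / real N + \<psi>) = cis \<psi> * w ^ i" for i
    by (simp add: w_def Complex.DeMoivre cis_mult ac_simps)
  ultimately show ?thesis
    by (simp add: sum_distrib_left[symmetric])
qed

lemma sum_cos_arith_progression: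
  assumes "N > 0" "\<not> int N dvd d"
  shows "(\<Sum>i<N. cos (2 * pi * of_int d * real i / real N + \<psi>)) = 0"
  using arg_cong[OF sum_cis_arith_progression[OF assms, of \<psi>], of Re] by simp

lemma sum_sin_arith_progression:
  assumes "N > 0" "\<not> int N dvd d"
  shows "(\<Sum>i<N. sin (2 * pi * of_int d * real i / real N + \<psi>)) = 0"
  using arg_cong[OF sum_cis_arith_progression[OF assms, of \<psi>], of Im] by simp

text \<open>
  The kernel \<open>cas\<close> of the Hartley transform replaces the complex exponentials: the modes
  \<open>i \<mapsto> cas (2 \<pi> m i / N)\<close> form a real orthogonal basis, so that all block decompositions stay real.
\<close>

definition cas :: "real \<Rightarrow> real" where
  "cas x = cos x + sin x"

text \<open>Product formula behind the orthogonality of the modes: the cosine of the difference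
  detects equal modes, the sine of the sum averages to zero.\<close>

lemma cas_mult: "cas x * cas y = cos (x - y) + sin (x + y)"
  by (simp add: cas_def cos_diff sin_add algebra_simps)

lemma cas_minus_mult: "cas (- x) * cas (- y) = cos (x - y) - sin (x + y)"
  by (simp add: cas_def cos_diff sin_add algebra_simps)

text \<open>Expansion about the midpoint \<open>x + a\<close>. Sums keep the wave, differences
  reflect it, in accordance with the derivative of \<open>cas x\<close> being
  \<open>cas (- x)\<close>.\<close>

lemma cas_shift:
  "cas (x + 2 * a) + cas x = 2 * cos a * cas (x + a)"
  "cas (x + 2 * a) - cas x = 2 * sin a * cas (- (x + a))"
  "cas (- (x + 2 * a)) + cas (- x) = 2 * cos a * cas (- (x + a))"
  "cas (- (x + 2 * a)) - cas (- x) = - 2 * sin a * cas (x + a)"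
proof -
  define y where "y = x + a"
  have x: "x + 2 * a = y + a" "x = y - a"
    by (simp_all add: y_def)
  have y: "x + a = y" by (simp add: y_def)
  show
    "cas (x + 2 * a) + cas x = 2 * cos a * cas (x + a)"
    "cas (x + 2 * a) - cas x = 2 * sin a * cas (- (x + a))"
    "cas (- (x + 2 * a)) + cas (- x) = 2 * cos a * cas (- (x + a))"
    "cas (- (x + 2 * a)) - cas (- x) = - 2 * sin a * cas (x + a)"
    unfolding x(1) y unfolding x(2)
    by (simp_all add: cas_def cos_add cos_diff sin_add sin_diff algebra_simps)
qed

text \<open>
  The phase of the mode \<open>m\<close> at the midpoint between the sites \<open>i\<close> and \<open>i + j\<close>. Both the relative radial
  and the relative tangential displacement of these sites become multiples of the same wave when
  expressed in it.
\<close>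

definition mid_phase :: "nat \<Rightarrow> nat \<Rightarrow> nat \<Rightarrow> nat \<Rightarrow> real" where
  "mid_phase N j m i = 2 * pi * real m * real i / real N + pi * real m * real j / real N"

lemma sum_cos_diff_mid_phase:
  assumes "m < N" "n < N"
  shows "(\<Sum>i<N. cos (mid_phase N j m i - mid_phase N j n i)) = (if m = n then real N else 0)"
proof (cases "m = n")
  case False
  have "\<not> int N dvd int m - int n"
    using assms False zdvd_not_zless[of "\<bar>int m - int n\<bar>" "int N"] by auto
  from sum_cos_arith_progression[OF _ this, of "pi * (real m - real n) * real j / real N"] assms False
  show ?thesis
    by (simp add: mid_phase_def algebra_simps diff_divide_distrib add_divide_distrib)
qed simp

text \<open>In the resonant case N | m + n the geometric sum does not cancel. There, with m + n = N
  q, every phase sum is an integer multiple of pi and each sine vanishes separately.\<close>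

lemma sum_sin_add_mid_phase:
  assumes "m < N"
  shows "(\<Sum>i<N. sin (mid_phase N j m i + mid_phase N j n i)) = 0"
proof (cases "int N dvd int m + int n")
  case False
  from sum_sin_arith_progression[OF _ False, of "pi * (real m + real n) * real j / real N"] assms
  show ?thesis
    by (simp add: mid_phase_def algebra_simps add_divide_distrib)
next
  case True
  then obtain q where "m + n = N * q"
    by (metis dvdE int_dvd_int_iff of_nat_add)
  then have q: "real m + real n = real N * real q"
    by (metis of_nat_add of_nat_mult)
  have "mid_phase N j m i + mid_phase N j n i = real (2 * q * i + q * j) * pi" for i
  proof -
    have "mid_phase N j m i + mid_phase N j n i = (real m + real n) / real N * (2 * real i + real j) * pi"
      by (simp add: mid_phase_def algebra_simps add_divide_distrib)
    also have "\<dots> = real (2 * q * i + q * j) * pi"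
      using assms by (simp add: q algebra_simps)
    finally show ?thesis .
  qed
  then show ?thesis
    by (simp only: sin_npi) simp
qed

lemma sum_cas_mid_phase:
  assumes "m < N" "n < N"
  shows "(\<Sum>i<N. cas (mid_phase N j m i) * cas (mid_phase N j n i)) = (if m = n then real N else 0)"
    and "(\<Sum>i<N. cas (- mid_phase N j m i) * cas (- mid_phase N j n i)) = (if m = n then real N else 0)"
  using assms
  by (simp_all only: cas_mult[of "mid_phase _ _ _ _"] cas_minus_mult sum.distrib sum_subtractf
      sum_cos_diff_mid_phase sum_sin_add_mid_phase add_0_right diff_zero)

text \<open>Parseval's identity: after expanding the square only the terms m = n survive.\<close>

lemma sum_square_orthogonal:
  fixes c :: "nat \<Rightarrow> real"
  assumes "\<And>m n. m < N \<Longrightarrow> n < N \<Longrightarrow> (\<Sum>i<N. f m i * f n i) = (if m = n then K else 0)"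
  shows "(\<Sum>i<N. (\<Sum>m<N. c m * f m i)\<^sup>2) = K * (\<Sum>m<N. (c m)\<^sup>2)"
proof -
  have "(\<Sum>i<N. (\<Sum>m<N. c m * f m i)\<^sup>2) = (\<Sum>i<N. \<Sum>m<N. \<Sum>n<N. c m * c n * (f m i * f n i))"
    by (simp add: power2_eq_square sum_product ac_simps)
  also have "\<dots> = (\<Sum>m<N. \<Sum>n<N. \<Sum>i<N. c m * c n * (f m i * f n i))"
    by (subst sum.swap) (intro sum.cong refl sum.swap)
  also have "\<dots> = (\<Sum>m<N. \<Sum>n<N. if m = n then c m * c n * K else 0)"
    by (intro sum.cong refl) (simp add: sum_distrib_left[symmetric] assms)
  also have "\<dots> = K * (\<Sum>m<N. (c m)\<^sup>2)"
    by (simp add: sum_distrib_left power2_eq_square ac_simps)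
  finally show ?thesis .
qed

lemma sum_square_cas_mid_phase:
  "(\<Sum>i<N. (\<Sum>m<N. c m * cas (mid_phase N j m i))\<^sup>2) = real N * (\<Sum>m<N. (c m)\<^sup>2)"
  "(\<Sum>i<N. (\<Sum>m<N. c m * cas (- mid_phase N j m i))\<^sup>2) = real N * (\<Sum>m<N. (c m)\<^sup>2)"
  by (rule sum_square_orthogonal; rule sum_cas_mid_phase; assumption)+

definition hartley_mode :: "nat \<Rightarrow> nat \<Rightarrow> nat \<Rightarrow> real" where
  "hartley_mode N m i = cas (2 * pi * real m * real i / real N)"

text \<open>
  Tangential displacements are expanded in the reflected modes: an antisymmetric circulant matrix maps
  \<open>cas x\<close> to a multiple of \<open>cas (- x)\<close>, so this choice makes the Hessian couple equal indices only.
\<close>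

definition hartley_mode' :: "nat \<Rightarrow> nat \<Rightarrow> nat \<Rightarrow> real" where
  "hartley_mode' N m i = cas (- (2 * pi * real m * real i / real N))"

lemma sum_hartley_mode:
  assumes "m < N" "n < N"
  shows "(\<Sum>i<N. hartley_mode N m i * hartley_mode N n i) = (if m = n then real N else 0)"
    and "(\<Sum>i<N. hartley_mode' N m i * hartley_mode' N n i) = (if m = n then real N else 0)"
  using sum_cas_mid_phase[OF assms, of 0] by (simp_all add: hartley_mode_def hartley_mode'_def mid_phase_def)

lemma hartley_mode_sym:
  "hartley_mode N m i = hartley_mode N i m" "hartley_mode' N m i = hartley_mode' N i m"
  by (simp_all add: hartley_mode_def hartley_mode'_def mult_ac)

text \<open>Symmetry of the kernel in mode and site turns orthogonality of the modes into
  completeness: the sum over modes is again an orthogonality sum.\<close>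

lemma orthogonal_inversion:
  fixes f :: "nat \<Rightarrow> nat \<Rightarrow> real"
  assumes "\<And>m n. m < N \<Longrightarrow> n < N \<Longrightarrow> (\<Sum>i<N. f m i * f n i) = (if m = n then real N else 0)"
    and sym: "\<And>m i. f m i = f i m" and "k < N"
  shows "(\<Sum>m<N. (\<Sum>i<N. x i * f m i) / real N * f m k) = x k"
proof -
  have e: "x i * f m i / real N * f m k = x i / real N * (f i m * f k m)" for m i
    by (subst sym[of m i], subst sym[of m k]) simp
  have "(\<Sum>m<N. (\<Sum>i<N. x i * f m i) / real N * f m k) = (\<Sum>m<N. \<Sum>i<N. x i / real N * (f i m * f k m))"
    by (simp only: sum_divide_distrib sum_distrib_right e)
  also have "\<dots> = (\<Sum>i<N. \<Sum>m<N. x i / real N * (f i m * f k m))"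
    by (rule sum.swap)
  also have "\<dots> = (\<Sum>i<N. if i = k then x i else 0)"
    unfolding sum_distrib_left[symmetric] using assms(1) \<open>k < N\<close> by (intro sum.cong refl) auto
  also have "\<dots> = x k"
    using \<open>k < N\<close> by simp
  finally show ?thesis .
qed

lemma sum_square_hartley_mode:
  "(\<Sum>i<N. (\<Sum>m<N. c m * hartley_mode N m i)\<^sup>2) = real N * (\<Sum>m<N. (c m)\<^sup>2)"
  "(\<Sum>i<N. (\<Sum>m<N. c m * hartley_mode' N m i)\<^sup>2) = real N * (\<Sum>m<N. (c m)\<^sup>2)"
  by (rule sum_square_orthogonal; rule sum_hartley_mode; assumption)+

lemma hartley_inversion:
  assumes "k < N"
  shows "(\<Sum>m<N. (\<Sum>i<N. x i * hartley_mode N m i) / real N * hartley_mode N m k) = x k"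
    and "(\<Sum>m<N. (\<Sum>i<N. x i * hartley_mode' N m i) / real N * hartley_mode' N m k) = x k"
  subgoal by (rule orthogonal_inversion[OF _ hartley_mode_sym(1) assms]) (rule sum_hartley_mode)
  subgoal by (rule orthogonal_inversion[OF _ hartley_mode_sym(2) assms]) (rule sum_hartley_mode)
  done

subsection \<open>The Hessian at the regular polygon in Hartley modes\<close>

text \<open>The factor |q_0 - q_j|^(-A) of the pair forces: vertices \<open>j\<close> steps apart
  are joined by a chord of this length.\<close>

definition bond_weight :: "nat \<Rightarrow> real \<Rightarrow> nat \<Rightarrow> real" where
  "bond_weight N A j = (polygon_radius N A * (2 * sin (pi * real j / real N))) powr (- A)"

text \<open>
  The Hessian on the \<open>m\<close>-th mode is the binary quadratic form with these coefficients. The summand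
  \<open>j = 0\<close> vanishes because \<open>bond_weight N A 0 = 0 powr (- A) = 0\<close>.
\<close>

definition radial_coeff :: "nat \<Rightarrow> real \<Rightarrow> nat \<Rightarrow> real" where
  "radial_coeff N A m = real N + 2 * (\<Sum>j<N. bond_weight N A j *
     ((A - 1) * (sin (pi * real j / real N) * cos (pi * real m * real j / real N))\<^sup>2
      - (cos (pi * real j / real N) * sin (pi * real m * real j / real N))\<^sup>2))"

definition tangential_coeff :: "nat \<Rightarrow> real \<Rightarrow> nat \<Rightarrow> real" where
  "tangential_coeff N A m = real N + 2 * (\<Sum>j<N. bond_weight N A j *
     ((A - 1) * (cos (pi * real j / real N) * sin (pi * real m * real j / real N))\<^sup>2
      - (sin (pi * real j / real N) * cos (pi * real m * real j / real N))\<^sup>2))"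

definition mixed_coeff :: "nat \<Rightarrow> real \<Rightarrow> nat \<Rightarrow> real" where
  "mixed_coeff N A m = - 2 * (A - 2) * (\<Sum>j<N. bond_weight N A j *
     (sin (pi * real j / real N) * cos (pi * real j / real N)
      * (sin (pi * real m * real j / real N) * cos (pi * real m * real j / real N))))"

abbreviation mode_det :: "nat \<Rightarrow> real \<Rightarrow> nat \<Rightarrow> real" where
  "mode_det N A m \<equiv> radial_coeff N A m * tangential_coeff N A m - (mixed_coeff N A m)\<^sup>2"

lemma sum_less_eq_half_sum:
  fixes f :: "nat \<Rightarrow> nat \<Rightarrow> real"
  assumes sym: "\<And>i k. f i k = f k i" and diag: "\<And>i. f i i = 0"
  shows "(\<Sum>k<N. \<Sum>i<k. f i k) = (\<Sum>i<N. \<Sum>k<N. f i k) / 2"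
proof (induction N)
  case (Suc N)
  have "(\<Sum>i<Suc N. \<Sum>k<Suc N. f i k) = (\<Sum>i<N. \<Sum>k<N. f i k) + (\<Sum>i<N. f i N) + (\<Sum>k<N. f N k)"
    by (simp add: sum.distrib diag)
  also have "(\<Sum>k<N. f N k) = (\<Sum>i<N. f i N)"
    by (intro sum.cong refl sym)
  finally show ?case
    by (simp add: Suc.IH)
qed simp

lemma sum_shift_periodic:
  fixes h :: "nat \<Rightarrow> real"
  assumes "\<And>k. h (k + N) = h k"
  shows "(\<Sum>j<N. h (i + j)) = (\<Sum>j<N. h j)"
proof (induction i)
  case (Suc i)
  have "(\<Sum>j<N. h (i + j)) + h (i + N) = h i + (\<Sum>j<N. h (Suc i + j))"
    using sum.lessThan_Suc[of "\<lambda>j. h (i + j)" N] sum.lessThan_Suc_shift[of "\<lambda>j. h (i + j)" N] by simp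
  then show ?case
    using Suc assms[of i] by simp
qed simp

section \<open>Chords and displacements in rotated frames\<close>

lemma inner_cis_mult: "(cis t * x) \<bullet> (cis t * y) = x \<bullet> y"
proof -
  have "(cis t * x) \<bullet> (cis t * y) = (x \<bullet> y) * ((cos t)\<^sup>2 + (sin t)\<^sup>2)"
    by (simp add: inner_complex_def del: sin_cos_squared_add sin_cos_squared_add2) algebra
  then show ?thesis by simp
qed

lemma pair_hess_swap: "pair_hess A (d - d') (u - u') (v - v') = pair_hess A (d' - d) (u' - u) (v' - v)"
proof -
  have "pair_hess A (- x) (- y) (- z) = pair_hess A x y z" for x y z
    by (simp add: pair_hess_def)
  from this[of "d' - d" "u' - u" "v' - v"] show ?thesis
    by simp
qed

text \<open>Defined at every index and N-periodic for positive N, whereas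
  \<open>regular_polygon\<close> is cut off at \<open>N\<close>; sums over i + j then need no
  reduction modulo N.\<close>

definition polygon_point :: "nat \<Rightarrow> real \<Rightarrow> nat \<Rightarrow> complex" where
  "polygon_point N A k = rcis (polygon_radius N A) (polygon_angles N k)"

text \<open>Components in the orthonormal frame at each vertex, \<open>x\<close> radial and
  \<open>y\<close> tangential. Tangential displacements are lengths, not angles, which is why powers
  of the radius appear in the polar blocks.\<close>

definition frame_vector :: "nat \<Rightarrow> (nat \<Rightarrow> real) \<Rightarrow> (nat \<Rightarrow> real) \<Rightarrow> nat \<Rightarrow> complex" where
  "frame_vector N x y k = cis (polygon_angles N k) * Complex (x k) (y k)"

lemma cis_polygon_angles_add:
  "N > 0 \<Longrightarrow> cis (polygon_angles N (k + N)) = cis (polygon_angles N k)"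
proof -
  assume "N > 0"
  then have "polygon_angles N (k + N) = polygon_angles N k + 2 * pi"
    by (simp add: polygon_angles_def field_simps)
  then show ?thesis
    by (simp flip: cis_mult)
qed

lemma cis_polygon_angles_shift:
  "cis (polygon_angles N i) = cis (polygon_angles N i + pi * real j / real N) * cis (- (pi * real j / real N))"
  "cis (polygon_angles N (i + j)) = cis (polygon_angles N i + pi * real j / real N) * cis (pi * real j / real N)"
  by (simp_all add: cis_mult polygon_angles_def add_divide_distrib algebra_simps)

text \<open>A chord is perpendicular to the ray through its midpoint. In the frame turned to the
  angle halfway between its ends it is purely tangential.\<close>

lemma polygon_point_diff:
  "polygon_point N A i - polygon_point N A (i + j)
   = cis (polygon_angles N i + pi * real j / real N)
     * Complex 0 (- (polygon_radius N A * (2 * sin (pi * real j / real N))))"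
  unfolding polygon_point_def rcis_def
    cis_polygon_angles_shift(1)[of N i j] cis_polygon_angles_shift(2)[of N i j]
  by (simp add: complex_eq_iff algebra_simps)

lemma frame_vector_diff:
  "frame_vector N x y i - frame_vector N x y (i + j)
   = cis (polygon_angles N i + pi * real j / real N) *
     Complex (cos (pi * real j / real N) * (x i - x (i + j)) + sin (pi * real j / real N) * (y i + y (i + j)))
             (cos (pi * real j / real N) * (y i - y (i + j)) - sin (pi * real j / real N) * (x i + x (i + j)))"
  unfolding frame_vector_def
    cis_polygon_angles_shift(1)[of N i j] cis_polygon_angles_shift(2)[of N i j]
  by (simp add: complex_eq_iff algebra_simps)

lemma sin_chord_nonneg: "j < N \<Longrightarrow> sin (pi * real j / real N) \<ge> 0"
  by (intro sin_ge_zero) (auto simp: field_simps)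

lemma sin_chord_pos: "0 < j \<Longrightarrow> j < N \<Longrightarrow> sin (pi * real j / real N) > 0"
  by (intro sin_gt_zero) (auto simp: field_simps)

locale polygon =
  fixes N :: nat and A :: real
  assumes N_ge: "N \<ge> 2" and A_gt: "A > 2"
begin

abbreviation "\<rho> \<equiv> polygon_radius N A"
abbreviation "bond \<equiv> bond_weight N A"

lemma \<rho>_pos: "\<rho> > 0"
  using polygon_radius_pos[OF N_ge] .

text \<open>The chord lies on the second axis of the midpoint frame. The pair potential has
  curvature (A - 1) along the chord and -1 across it, times the weight.\<close>

lemma pair_hess_polygon_point:
  assumes "j < N"
  shows "pair_hess A (polygon_point N A i - polygon_point N A (i + j))
           (cis (polygon_angles N i + pi * real j / real N) * Complex a b)
           (cis (polygon_angles N i + pi * real j / real N) * Complex a' b')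
         = bond j * ((A - 1) * (b * b') - a * a')"
proof -
  define d where "d = \<rho> * (2 * sin (pi * real j / real N))"
  have "d \<ge> 0"
    using \<rho>_pos sin_chord_nonneg[OF assms] by (simp add: d_def)
  have norm: "norm (cis t * Complex 0 (- d)) = d" for t
    using \<open>d \<ge> 0\<close> unfolding norm_mult norm_cis by (simp add: cmod_def)
  \<comment> \<open>The case \<open>j = 0\<close> is included: there d = 0, and both sides vanish
    because \<open>0 powr p = 0\<close>.\<close>
  have "d powr (- A - 2) * d\<^sup>2 = d powr (- A)"
    using \<open>d \<ge> 0\<close> by (cases "d = 0") (simp_all flip: powr_numeral powr_add)
  then have "A * d powr (- A - 2) * (- d * b) * (- d * b') = A * d powr (- A) * (b * b')"
    by (simp add: power2_eq_square algebra_simps)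
  then show ?thesis
    unfolding polygon_point_diff d_def[symmetric] pair_hess_def inner_cis_mult norm
    by (simp add: bond_weight_def d_def[symmetric] inner_complex_def algebra_simps)
qed

text \<open>The full double sum counts each pair twice, whence the weights
  \<open>bond j / 2\<close>; periodicity then groups the pairs by the number \<open>j\<close> of
  steps between their ends.\<close>

lemma energy_hess_frame_vector:
  assumes x: "\<And>k. x (k + N) = x k" and y: "\<And>k. y (k + N) = y k"
  shows "energy_hess N A (polygon_point N A) (frame_vector N x y) (frame_vector N x y) =
    real N * (\<Sum>i<N. (x i)\<^sup>2 + (y i)\<^sup>2) + (\<Sum>j<N. bond j / 2 * (
      (A - 1) * (\<Sum>i<N. (cos (pi * real j / real N) * (y i - y (i + j))
                           - sin (pi * real j / real N) * (x i + x (i + j)))\<^sup>2)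
      - (\<Sum>i<N. (cos (pi * real j / real N) * (x i - x (i + j))
                   + sin (pi * real j / real N) * (y i + y (i + j)))\<^sup>2)))"
proof -
  define h where "h i k = pair_hess A (polygon_point N A i - polygon_point N A k)
      (frame_vector N x y i - frame_vector N x y k) (frame_vector N x y i - frame_vector N x y k)" for i k
  have inner: "frame_vector N x y i \<bullet> frame_vector N x y i = (x i)\<^sup>2 + (y i)\<^sup>2" for i
    unfolding frame_vector_def inner_cis_mult by (simp add: inner_complex_def power2_eq_square)
  have "N > 0" using N_ge by simp
  have per: "h i (k + N) = h i k" for i k
    by (simp add: h_def polygon_point_def rcis_def frame_vector_def
        cis_polygon_angles_add[OF \<open>N > 0\<close>] x y)
  have "(\<Sum>k<N. \<Sum>i<k. h i k) = (\<Sum>i<N. \<Sum>k<N. h i k) / 2"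
  proof (rule sum_less_eq_half_sum)
    show "h i k = h k i" for i k
      unfolding h_def by (rule pair_hess_swap)
    show "h i i = 0" for i
      by (simp add: h_def pair_hess_def)
  qed
  also have "(\<Sum>i<N. \<Sum>k<N. h i k) = (\<Sum>i<N. \<Sum>j<N. h i (i + j))"
    by (intro sum.cong refl sum_shift_periodic[symmetric] per)
  also have "\<dots> = (\<Sum>j<N. \<Sum>i<N. h i (i + j))"
    by (rule sum.swap)
  also have "\<dots> / 2 = (\<Sum>j<N. bond j / 2 * (
      (A - 1) * (\<Sum>i<N. (cos (pi * real j / real N) * (y i - y (i + j))
                           - sin (pi * real j / real N) * (x i + x (i + j)))\<^sup>2)
      - (\<Sum>i<N. (cos (pi * real j / real N) * (x i - x (i + j))
                   + sin (pi * real j / real N) * (y i + y (i + j)))\<^sup>2)))"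
    by (simp add: h_def frame_vector_diff pair_hess_polygon_point sum_subtractf
        flip: sum_distrib_left sum_divide_distrib power2_eq_square)
  finally show ?thesis
    unfolding energy_hess_def h_def[symmetric] inner by (rule arg_cong)
qed

definition mode_config :: "(nat \<Rightarrow> real) \<Rightarrow> (nat \<Rightarrow> real) \<Rightarrow> nat \<Rightarrow> complex" where
  "mode_config a b = frame_vector N (\<lambda>i. \<Sum>m<N. a m * hartley_mode N m i) (\<lambda>i. \<Sum>m<N. b m * hartley_mode' N m i)"

lemma hartley_mode_periodic:
  "hartley_mode N m (i + N) = hartley_mode N m i" "hartley_mode' N m (i + N) = hartley_mode' N m i"
proof -
  have "2 * pi * real m * real (i + N) / real N = 2 * pi * real m * real i / real N + 2 * pi * real m"
    using N_ge by (simp add: field_simps)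
  then show "hartley_mode N m (i + N) = hartley_mode N m i" "hartley_mode' N m (i + N) = hartley_mode' N m i"
    using sin_2npi[of m] cos_2npi[of m]
    by (simp_all add: hartley_mode_def hartley_mode'_def cas_def sin_add cos_add mult_ac sin_diff cos_diff)
qed

lemma hartley_mode_shift:
  "hartley_mode N m i + hartley_mode N m (i + j)
     = 2 * cos (pi * real m * real j / real N) * cas (mid_phase N j m i)"
  "hartley_mode N m i - hartley_mode N m (i + j)
     = - 2 * sin (pi * real m * real j / real N) * cas (- mid_phase N j m i)"
  "hartley_mode' N m i + hartley_mode' N m (i + j)
     = 2 * cos (pi * real m * real j / real N) * cas (- mid_phase N j m i)"
  "hartley_mode' N m i - hartley_mode' N m (i + j)
     = 2 * sin (pi * real m * real j / real N) * cas (mid_phase N j m i)"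
proof -
  have eq: "2 * pi * real m * real (i + j) / real N
      = 2 * pi * real m * real i / real N + 2 * (pi * real m * real j / real N)"
    by (simp add: algebra_simps add_divide_distrib)
  show
    "hartley_mode N m i + hartley_mode N m (i + j)
       = 2 * cos (pi * real m * real j / real N) * cas (mid_phase N j m i)"
    "hartley_mode N m i - hartley_mode N m (i + j)
       = - 2 * sin (pi * real m * real j / real N) * cas (- mid_phase N j m i)"
    "hartley_mode' N m i + hartley_mode' N m (i + j)
       = 2 * cos (pi * real m * real j / real N) * cas (- mid_phase N j m i)"
    "hartley_mode' N m i - hartley_mode' N m (i + j)
       = 2 * sin (pi * real m * real j / real N) * cas (mid_phase N j m i)"
    using cas_shift[of "2 * pi * real m * real i / real N" "pi * real m * real j / real N"]
    unfolding hartley_mode_def hartley_mode'_def mid_phase_def eq by linarith+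
qed

text \<open>For a fixed step \<open>j\<close>, displacements along the chord expand in the midpoint
  waves and displacements across it in the reflected ones. Each family is orthogonal over the sites,
  so Parseval's identity separates the modes for each \<open>j\<close>.\<close>

lemma energy_hess_mode_config:
  "energy_hess N A (polygon_point N A) (mode_config a b) (mode_config a b)
   = real N * (\<Sum>m<N. radial_coeff N A m * (a m)\<^sup>2 + 2 * mixed_coeff N A m * a m * b m
                      + tangential_coeff N A m * (b m)\<^sup>2)"
proof -
  define x where "x i = (\<Sum>m<N. a m * hartley_mode N m i)" for i
  define y where "y i = (\<Sum>m<N. b m * hartley_mode' N m i)" for i
  define sb where "sb j = sin (pi * real j / real N)" for j
  define cb where "cb j = cos (pi * real j / real N)" for j
  define s where "s m j = sin (pi * real m * real j / real N)" for m j
  define c where "c m j = cos (pi * real m * real j / real N)" for m j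
  note shift = hartley_mode_shift[folded s_def c_def]
  have tang: "cb j * (y i - y (i + j)) - sb j * (x i + x (i + j))
      = (\<Sum>m<N. 2 * (cb j * s m j * b m - sb j * c m j * a m) * cas (mid_phase N j m i))" for i j
  proof -
    have "cb j * (y i - y (i + j)) - sb j * (x i + x (i + j))
      = (\<Sum>m<N. cb j * b m * (hartley_mode' N m i - hartley_mode' N m (i + j))
                  - sb j * a m * (hartley_mode N m i + hartley_mode N m (i + j)))"
      by (simp add: x_def y_def algebra_simps sum.distrib sum_subtractf sum_distrib_left)
    then show ?thesis
      unfolding shift by (simp add: algebra_simps)
  qed
  have rad: "cb j * (x i - x (i + j)) + sb j * (y i + y (i + j))
      = (\<Sum>m<N. 2 * (sb j * c m j * b m - cb j * s m j * a m) * cas (- mid_phase N j m i))" for i j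
  proof -
    have "cb j * (x i - x (i + j)) + sb j * (y i + y (i + j))
      = (\<Sum>m<N. cb j * a m * (hartley_mode N m i - hartley_mode N m (i + j))
                  + sb j * b m * (hartley_mode' N m i + hartley_mode' N m (i + j)))"
      by (simp add: x_def y_def algebra_simps sum.distrib sum_subtractf sum_distrib_left)
    then show ?thesis
      unfolding shift by (simp add: algebra_simps)
  qed
  have norms: "(\<Sum>i<N. (x i)\<^sup>2 + (y i)\<^sup>2) = real N * (\<Sum>m<N. (a m)\<^sup>2 + (b m)\<^sup>2)"
    by (simp add: x_def y_def sum.distrib distrib_left sum_square_hartley_mode)
  have quarter: "g / 2 * ((A - 1) * (K * (\<Sum>m<N. (2 * X m)\<^sup>2)) - K * (\<Sum>m<N. (2 * Y m)\<^sup>2))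
      = K * (\<Sum>m<N. 2 * g * ((A - 1) * (X m)\<^sup>2 - (Y m)\<^sup>2))" for g K :: real and X Y :: "nat \<Rightarrow> real"
  proof -
    have "(\<Sum>m<N. (2 * Z m)\<^sup>2) = 4 * (\<Sum>m<N. (Z m)\<^sup>2)" for Z :: "nat \<Rightarrow> real"
      by (simp add: power_mult_distrib flip: sum_distrib_left)
    moreover have "(\<Sum>m<N. 2 * g * ((A - 1) * (X m)\<^sup>2 - (Y m)\<^sup>2))
        = 2 * g * ((A - 1) * (\<Sum>m<N. (X m)\<^sup>2) - (\<Sum>m<N. (Y m)\<^sup>2))"
      by (simp only: sum_subtractf flip: sum_distrib_left)
    ultimately show ?thesis
      by (simp only:) (simp add: field_simps)
  qed
  have factor: "K * X + (\<Sum>j<N. K * Y j) = K * (X + (\<Sum>j<N. Y j))" for K X :: real and Y :: "nat \<Rightarrow> real"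
    by (simp add: distrib_left sum_distrib_left)
  have config: "mode_config a b = frame_vector N x y"
    by (simp add: mode_config_def x_def[abs_def] y_def[abs_def])
  have periodic: "x (k + N) = x k" "y (k + N) = y k" for k
    by (simp_all add: x_def y_def hartley_mode_periodic)
  have "energy_hess N A (polygon_point N A) (mode_config a b) (mode_config a b)
     = real N * (real N * (\<Sum>m<N. (a m)\<^sup>2 + (b m)\<^sup>2)) + (\<Sum>j<N. bond j / 2 * (
        (A - 1) * (real N * (\<Sum>m<N. (2 * (cb j * s m j * b m - sb j * c m j * a m))\<^sup>2))
        - real N * (\<Sum>m<N. (2 * (sb j * c m j * b m - cb j * s m j * a m))\<^sup>2)))"
    unfolding config energy_hess_frame_vector[of x y, OF periodic, folded sb_def cb_def] norms tang rad
      sum_square_cas_mid_phase by (rule refl)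
  also have "\<dots> = real N * (real N * (\<Sum>m<N. (a m)\<^sup>2 + (b m)\<^sup>2) + (\<Sum>j<N. \<Sum>m<N. 2 * bond j *
        ((A - 1) * (cb j * s m j * b m - sb j * c m j * a m)\<^sup>2
          - (sb j * c m j * b m - cb j * s m j * a m)\<^sup>2)))"
    unfolding quarter factor by (rule refl)
  also have "(\<Sum>j<N. \<Sum>m<N. 2 * bond j *
        ((A - 1) * (cb j * s m j * b m - sb j * c m j * a m)\<^sup>2
          - (sb j * c m j * b m - cb j * s m j * a m)\<^sup>2))
     = (\<Sum>m<N. \<Sum>j<N. 2 * bond j *
        ((A - 1) * (cb j * s m j * b m - sb j * c m j * a m)\<^sup>2
          - (sb j * c m j * b m - cb j * s m j * a m)\<^sup>2))"
    by (rule sum.swap)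
  also have "\<dots> = (\<Sum>m<N. (radial_coeff N A m - real N) * (a m)\<^sup>2 + 2 * mixed_coeff N A m * a m * b m
                      + (tangential_coeff N A m - real N) * (b m)\<^sup>2)"
    unfolding radial_coeff_def tangential_coeff_def mixed_coeff_def
      sb_def[symmetric] cb_def[symmetric] s_def[symmetric] c_def[symmetric]
  proof (intro sum.cong refl)
    fix m
    \<comment> \<open>The cross terms of the two squares carry the weights A - 1 and -1; their sum
      is the factor A - 2 of \<open>mixed_coeff\<close>.\<close>
    have expand: "2 * g * ((A - 1) * (u * y - w * x)\<^sup>2 - (w * y - u * x)\<^sup>2)
      = 2 * x\<^sup>2 * (g * ((A - 1) * w\<^sup>2 - u\<^sup>2)) + (2 * y\<^sup>2 * (g * ((A - 1) * u\<^sup>2 - w\<^sup>2))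
        + - 4 * (A - 2) * x * y * (g * (u * w)))" for g u w x y :: real
      by (simp add: power2_eq_square algebra_simps)
    have mixed: "sb j * cb j * (s m j * c m j) = cb j * s m j * (sb j * c m j)" for j
      by simp
    define F1 where "F1 = (\<Sum>j<N. bond j * ((A - 1) * (sb j * c m j)\<^sup>2 - (cb j * s m j)\<^sup>2))"
    define F2 where "F2 = (\<Sum>j<N. bond j * ((A - 1) * (cb j * s m j)\<^sup>2 - (sb j * c m j)\<^sup>2))"
    define F3 where "F3 = (\<Sum>j<N. bond j * (sb j * cb j * (s m j * c m j)))"
    have "(\<Sum>j<N. 2 * bond j * ((A - 1) * (cb j * s m j * b m - sb j * c m j * a m)\<^sup>2
          - (sb j * c m j * b m - cb j * s m j * a m)\<^sup>2))
      = (\<Sum>j<N. 2 * (a m)\<^sup>2 * (bond j * ((A - 1) * (sb j * c m j)\<^sup>2 - (cb j * s m j)\<^sup>2))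
          + (2 * (b m)\<^sup>2 * (bond j * ((A - 1) * (cb j * s m j)\<^sup>2 - (sb j * c m j)\<^sup>2))
          + - 4 * (A - 2) * a m * b m * (bond j * (sb j * cb j * (s m j * c m j)))))"
      by (simp only: expand mixed)
    also have "\<dots> = 2 * (a m)\<^sup>2 * F1 + (2 * (b m)\<^sup>2 * F2 + - 4 * (A - 2) * a m * b m * F3)"
      by (simp only: sum.distrib F1_def F2_def F3_def flip: sum_distrib_left)
    also have "\<dots> = (real N + 2 * F1 - real N) * (a m)\<^sup>2 + 2 * (- 2 * (A - 2) * F3) * a m * b m
        + (real N + 2 * F2 - real N) * (b m)\<^sup>2"
      by (simp add: algebra_simps)
    finally show "(\<Sum>j<N. 2 * bond j * ((A - 1) * (cb j * s m j * b m - sb j * c m j * a m)\<^sup>2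
          - (sb j * c m j * b m - cb j * s m j * a m)\<^sup>2))
      = (real N + 2 * (\<Sum>j<N. bond j * ((A - 1) * (sb j * c m j)\<^sup>2 - (cb j * s m j)\<^sup>2)) - real N) * (a m)\<^sup>2
        + 2 * (- 2 * (A - 2) * (\<Sum>j<N. bond j * (sb j * cb j * (s m j * c m j)))) * a m * b m
        + (real N + 2 * (\<Sum>j<N. bond j * ((A - 1) * (cb j * s m j)\<^sup>2 - (sb j * c m j)\<^sup>2)) - real N) * (b m)\<^sup>2"
      unfolding F1_def F2_def F3_def .
  qed
  also have "real N * (\<Sum>m<N. (a m)\<^sup>2 + (b m)\<^sup>2) + \<dots> =
      (\<Sum>m<N. radial_coeff N A m * (a m)\<^sup>2 + 2 * mixed_coeff N A m * a m * b m
                      + tangential_coeff N A m * (b m)\<^sup>2)"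
    unfolding sum_distrib_left sum.distrib[symmetric] by (intro sum.cong refl) (simp add: algebra_simps)
  finally show ?thesis .
qed

end

subsection \<open>The Morse index\<close>

lemma sum_fun_apply: "(\<Sum>i\<in>I. f i) x = (\<Sum>i\<in>I. f i x :: 'a :: comm_monoid_add)"
  by (induction I rule: infinite_finite_induct) simp_all

lemma scaleR_fun_apply: "(c *\<^sub>R f) x = c *\<^sub>R f x"
  by (simp add: scaleR_fun_def)

definition unit_vector :: "nat \<Rightarrow> nat \<Rightarrow> real" where
  "unit_vector m = (\<lambda>k. if k = m then 1 else 0)"

lemma inj_unit_vector: "inj unit_vector"
  by (rule injI) (metis unit_vector_def zero_neq_one)

lemma sum_unit_vector:
  assumes "finite I"
  shows "(\<Sum>m\<in>I. c m *\<^sub>R unit_vector m) = (\<lambda>k. if k \<in> I then c k else 0)"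
proof
  fix k
  have "(\<Sum>m\<in>I. c m *\<^sub>R unit_vector m) k = (\<Sum>m\<in>I. if k = m then c m else 0)"
    unfolding sum_fun_apply by (intro sum.cong refl) (simp add: scaleR_fun_def unit_vector_def)
  then show "(\<Sum>m\<in>I. c m *\<^sub>R unit_vector m) k = (if k \<in> I then c k else 0)"
    using assms by simp
qed

lemma independent_unit_vectors:
  assumes "finite I"
  shows "independent (unit_vector ` I)"
proof -
  have "u v = 0" if sum0: "(\<Sum>v\<in>unit_vector ` I. u v *\<^sub>R v) = 0" and "v \<in> unit_vector ` I" for u v
  proof -
    have "(\<Sum>m\<in>I. u (unit_vector m) *\<^sub>R unit_vector m) = 0"
      using sum0 by (simp add: sum.reindex inj_on_subset[OF inj_unit_vector])
    then have "(\<lambda>k. if k \<in> I then u (unit_vector k) else 0) = (\<lambda>k. 0)"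
      using sum_unit_vector[OF assms] by (simp add: zero_fun_def)
    with \<open>v \<in> unit_vector ` I\<close> show ?thesis
      by (metis imageE)
  qed
  then show ?thesis
    using assms by (auto simp: dependent_finite)
qed

lemma span_unit_vectors:
  assumes "finite I"
  shows "span (unit_vector ` I) = {c. \<forall>m. m \<notin> I \<longrightarrow> c m = 0}"
proof
  have "subspace {c :: nat \<Rightarrow> real. \<forall>m. m \<notin> I \<longrightarrow> c m = 0}"
    by (rule subspaceI) (auto simp: scaleR_fun_def)
  then show "span (unit_vector ` I) \<subseteq> {c. \<forall>m. m \<notin> I \<longrightarrow> c m = 0}"
    by (rule span_minimal[rotated]) (auto simp: unit_vector_def)
  show "{c. \<forall>m. m \<notin> I \<longrightarrow> c m = 0} \<subseteq> span (unit_vector ` I)"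
  proof
    fix c :: "nat \<Rightarrow> real"
    assume "c \<in> {c. \<forall>m. m \<notin> I \<longrightarrow> c m = 0}"
    then have "c = (\<Sum>m\<in>I. c m *\<^sub>R unit_vector m)"
      unfolding sum_unit_vector[OF assms] by auto
    also have "\<dots> \<in> span (unit_vector ` I)"
      by (intro span_sum span_scale span_base imageI)
    finally show "c \<in> span (unit_vector ` I)" .
  qed
qed

text \<open>Serves the upper bound of the index. A basis of \<open>U\<close> is mapped injectively
  to an independent set inside the span of the finite set \<open>B\<close>.\<close>

lemma dim_le_card_linear_inj:
  fixes f :: "'a::real_vector \<Rightarrow> 'b::real_vector"
  assumes f: "linear f" and U: "subspace U" and inj: "\<And>v. v \<in> U \<Longrightarrow> f v = 0 \<Longrightarrow> v = 0"
    and B: "finite B" "f ` U \<subseteq> span B"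
  shows "dim U \<le> card B"
proof -
  obtain C where C: "C \<subseteq> U" "independent C" "U \<subseteq> span C" "card C = dim U"
    by (rule basis_exists)
  have "span C \<subseteq> U"
    by (rule span_minimal[OF C(1) U])
  have "inj_on f (span C)"
    using inj \<open>span C \<subseteq> U\<close> by (auto simp: linear_inj_on_iff_eq_0[OF f subspace_span])
  then have "independent (f ` C)"
    by (rule linear_independent_injective_image[OF f C(2)])
  moreover have "f ` C \<subseteq> span B"
    using B C(1) by blast
  ultimately have "card (f ` C) \<le> card B"
    using independent_span_bound[OF B(1)] by blast
  moreover have "inj_on f C"
    using \<open>inj_on f (span C)\<close> span_superset by (rule inj_on_subset)
  ultimately show ?thesis
    using C(4) by (simp add: card_image)
qed

text \<open>Serves the lower bound of the index: an injective parametrization by coefficients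
  supported on \<open>I\<close> carries the unit vectors to a basis.\<close>

lemma dim_linear_image_unit_vectors:
  fixes f :: "(nat \<Rightarrow> real) \<Rightarrow> 'b::real_vector"
  assumes f: "linear f" and "finite I"
    and inj: "\<And>c. (\<And>m. m \<notin> I \<Longrightarrow> c m = 0) \<Longrightarrow> f c = 0 \<Longrightarrow> c = 0"
  shows "dim (f ` span (unit_vector ` I)) = card I"
proof -
  have inj': "inj_on f (span (unit_vector ` I))"
    unfolding linear_inj_on_iff_eq_0[OF f subspace_span]
    by (intro ballI impI inj) (simp_all add: span_unit_vectors[OF \<open>finite I\<close>])
  then have "independent (f ` (unit_vector ` I))"
    by (rule linear_independent_injective_image[OF f independent_unit_vectors[OF \<open>finite I\<close>]])
  then have "dim (f ` span (unit_vector ` I)) = card (f ` (unit_vector ` I))"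
    by (simp add: dim_eq_card_independent flip: linear_span_image[OF f])
  also have "\<dots> = card I"
    using inj_on_subset[OF inj' span_superset] inj_on_subset[OF inj_unit_vector]
    by (simp add: card_image)
  finally show ?thesis .
qed

text \<open>The square is completed in \<open>b\<close> because \<open>Q\<close> will be the
  tangential coefficient, whose sign is known; the remainder then has the sign of the
  determinant.\<close>

lemma quadratic_form_complete_square:
  fixes P \<sigma> Q a b :: real
  assumes "Q \<noteq> 0"
  shows "P * a\<^sup>2 + 2 * \<sigma> * a * b + Q * b\<^sup>2 = (Q * b + \<sigma> * a)\<^sup>2 / Q + (P * Q - \<sigma>\<^sup>2) / Q * a\<^sup>2"
  using assms by (simp add: field_simps power2_eq_square)

lemma quadratic_form_pos:
  fixes P \<sigma> Q a b :: real
  assumes "Q > 0" "P * Q - \<sigma>\<^sup>2 > 0" "a \<noteq> 0 \<or> b \<noteq> 0"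
  shows "P * a\<^sup>2 + 2 * \<sigma> * a * b + Q * b\<^sup>2 > 0"
proof (cases "a = 0")
  case False
  have "(Q * b + \<sigma> * a)\<^sup>2 / Q \<ge> 0" "(P * Q - \<sigma>\<^sup>2) / Q * a\<^sup>2 > 0"
    using assms False by simp_all
  then have "(Q * b + \<sigma> * a)\<^sup>2 / Q + (P * Q - \<sigma>\<^sup>2) / Q * a\<^sup>2 > 0"
    by (rule add_nonneg_pos)
  then show ?thesis
    using assms by (simp only: quadratic_form_complete_square)
qed (use assms in simp)

lemma energy_hess_cong:
  assumes "\<And>i. i < N \<Longrightarrow> z i = z' i" "\<And>i. i < N \<Longrightarrow> u i = u' i" "\<And>i. i < N \<Longrightarrow> v i = v' i"
  shows "energy_hess N A z u v = energy_hess N A z' u' v'"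
  unfolding energy_hess_def using assms by (auto intro!: arg_cong2[where f = "(+)"] sum.cong)

section \<open>Mode coordinates on the space of configurations\<close>

context polygon
begin

definition radial_mode :: "(nat \<Rightarrow> complex) \<Rightarrow> nat \<Rightarrow> real" where
  "radial_mode v m = (\<Sum>i<N. Re (cis (- polygon_angles N i) * v i) * hartley_mode N m i) / real N"

definition tangential_mode :: "(nat \<Rightarrow> complex) \<Rightarrow> nat \<Rightarrow> real" where
  "tangential_mode v m = (\<Sum>i<N. Im (cis (- polygon_angles N i) * v i) * hartley_mode' N m i) / real N"

text \<open>The truncation at \<open>N\<close> is needed for membership in \<open>configs N\<close>,
  since \<open>mode_config\<close> is periodic.\<close>

definition mode_vector :: "(nat \<Rightarrow> real) \<Rightarrow> (nat \<Rightarrow> real) \<Rightarrow> nat \<Rightarrow> complex" where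
  "mode_vector a b = (\<lambda>k. if k < N then mode_config a b k else 0)"

lemma mode_vector_modes:
  assumes "v \<in> configs N"
  shows "mode_vector (radial_mode v) (tangential_mode v) = v"
proof
  fix k
  show "mode_vector (radial_mode v) (tangential_mode v) k = v k"
  proof (cases "k < N")
    case True
    define w where "w i = cis (- polygon_angles N i) * v i" for i
    have "mode_vector (radial_mode v) (tangential_mode v) k
        = cis (polygon_angles N k) * Complex (Re (w k)) (Im (w k))"
      using True
      by (simp only: mode_vector_def mode_config_def frame_vector_def radial_mode_def tangential_mode_def
          hartley_inversion[OF True] w_def if_True)
    also have "\<dots> = v k"
      unfolding complex.collapse by (simp add: w_def cis_mult flip: mult.assoc)
    finally show ?thesis .
  next
    case False
    then show ?thesis
      using assms by (simp add: mode_vector_def configs_def)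
  qed
qed

lemma collision_free_regular_polygon: "collision_free N (regular_polygon N A)"
  unfolding collision_free_def
proof (intro allI impI)
  fix i k assume "k < N" "i < k"
  then have "cis (2 * pi * real i / real N) \<noteq> cis (2 * pi * real k / real N)"
    using Complex.bij_betw_roots_unity[of N] by (auto simp: bij_betw_def inj_on_def)
  then show "regular_polygon N A i \<noteq> regular_polygon N A k"
    using \<rho>_pos \<open>k < N\<close> \<open>i < k\<close>
    by (simp add: regular_polygon_def from_polar_def rcis_def polygon_radii_def polygon_angles_def)
qed

lemma regular_polygon_eq_point: "k < N \<Longrightarrow> regular_polygon N A k = polygon_point N A k"
  by (simp add: regular_polygon_def from_polar_def polygon_radii_def polygon_point_def)

lemma hessian_quot_mode_vector:
  "hessian_quot N A (regular_polygon N A) (mode_vector a b) (mode_vector a b)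
   = real N * (\<Sum>m<N. radial_coeff N A m * (a m)\<^sup>2 + 2 * mixed_coeff N A m * a m * b m
                      + tangential_coeff N A m * (b m)\<^sup>2)"
proof -
  have "hessian_quot N A (regular_polygon N A) (mode_vector a b) (mode_vector a b)
      = energy_hess N A (polygon_point N A) (mode_config a b) (mode_config a b)"
    unfolding hessian_quot_eq_energy_hess[OF A_gt collision_free_regular_polygon]
    by (rule energy_hess_cong) (simp_all add: regular_polygon_eq_point mode_vector_def)
  then show ?thesis
    by (simp add: energy_hess_mode_config)
qed

lemma hartley_mode_zero: "hartley_mode N 0 i = 1" "hartley_mode' N 0 i = 1"
  by (simp_all add: hartley_mode_def hartley_mode'_def cas_def)

text \<open>A constant tangential displacement is an infinitesimal rotation, so tangential mode 0 is
  the orbit direction.\<close>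

lemma mode_vector_rotation:
  "mode_vector (\<lambda>_. 0) (\<lambda>m. if m = 0 then c else 0)
   = (\<lambda>k. if k < N then cis (polygon_angles N k) * Complex 0 c else 0)"
proof
  fix k
  have "(\<Sum>m<N. (if m = 0 then c else 0) * hartley_mode' N m k)
      = (\<Sum>m<N. if m = 0 then c * hartley_mode' N 0 k else 0)"
    by (intro sum.cong) auto
  also have "\<dots> = c"
    using N_ge by (simp add: hartley_mode_zero)
  finally show "mode_vector (\<lambda>_. 0) (\<lambda>m. if m = 0 then c else 0) k
      = (if k < N then cis (polygon_angles N k) * Complex 0 c else 0)"
    by (simp add: mode_vector_def mode_config_def frame_vector_def)
qed

lemma orbit_tangent_eq:
  "orbit_tangent (regular_polygon N A) = range (\<lambda>c. mode_vector (\<lambda>_. 0) (\<lambda>m. if m = 0 then c else 0))"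
proof -
  \<comment> \<open>The generator of the rotation has tangential length \<open>\<rho>\<close> at
    each vertex; since \<open>\<rho>\<close> is positive, rescaling the parameter by it gives the
    same line.\<close>
  have tangent: "c *\<^sub>R (\<lambda>i. \<i> * regular_polygon N A i)
      = mode_vector (\<lambda>_. 0) (\<lambda>m. if m = 0 then c * \<rho> else 0)" for c
    unfolding mode_vector_rotation
    by (rule ext) (simp add: scaleR_fun_def regular_polygon_def from_polar_def polygon_radii_def rcis_def
        complex_eq_iff)
  have "range (\<lambda>c. mode_vector (\<lambda>_. 0) (\<lambda>m. if m = 0 then c * \<rho> else 0))
      = (\<lambda>c. mode_vector (\<lambda>_. 0) (\<lambda>m. if m = 0 then c else 0)) ` range (\<lambda>c. c * \<rho>)"
    by (simp add: image_image)
  also have "range (\<lambda>c. c * \<rho>) = UNIV"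
    using \<rho>_pos by (auto intro!: image_eqI[where x = "x / \<rho>" for x])
  finally show ?thesis
    by (simp add: orbit_tangent_def span_singleton tangent)
qed

lemma dim_orbit_tangent: "dim (orbit_tangent (regular_polygon N A)) = 1"
proof -
  have "regular_polygon N A 0 \<noteq> 0"
    using \<rho>_pos N_ge by (simp add: regular_polygon_def from_polar_def polygon_radii_def)
  then have "(\<lambda>i. \<i> * regular_polygon N A i) \<noteq> 0"
    by (metis complex_i_not_zero mult_eq_0_iff zero_fun_apply)
  then show ?thesis
    by (simp add: orbit_tangent_def dim_eq_card_independent)
qed

lemma mode_vector_add: "mode_vector (a + a') (b + b') = mode_vector a b + mode_vector a' b'"
  by (rule ext) (simp add: mode_vector_def mode_config_def frame_vector_def sum.distrib distrib_left
      distrib_right complex_eq_iff)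

lemma mode_vector_scaleR: "mode_vector (c *\<^sub>R a) (c *\<^sub>R b) = c *\<^sub>R mode_vector a b"
  by (rule ext) (simp add: mode_vector_def mode_config_def frame_vector_def scaleR_fun_def mult.assoc
      complex_eq_iff algebra_simps flip: sum_distrib_left)

lemma radial_mode_linear:
  "radial_mode (v + w) m = radial_mode v m + radial_mode w m"
  "radial_mode (c *\<^sub>R v) m = c * radial_mode v m"
  by (simp_all only: radial_mode_def plus_fun_apply scaleR_fun_apply distrib_left distrib_right
      plus_complex.sel scaleR_complex.sel mult_scaleR_right mult.assoc sum.distrib add_divide_distrib
      times_divide_eq_right flip: sum_distrib_left)

lemma tangential_mode_linear:
  "tangential_mode (v + w) m = tangential_mode v m + tangential_mode w m"
  "tangential_mode (c *\<^sub>R v) m = c * tangential_mode v m"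
  by (simp_all only: tangential_mode_def plus_fun_apply scaleR_fun_apply distrib_left distrib_right
      plus_complex.sel scaleR_complex.sel mult_scaleR_right mult.assoc sum.distrib add_divide_distrib
      times_divide_eq_right flip: sum_distrib_left)

lemma mode_vector_zero:
  assumes "\<And>m. m < N \<Longrightarrow> a m = 0" "\<And>m. m < N \<Longrightarrow> b m = 0"
  shows "mode_vector a b = 0"
  by (rule ext) (simp add: mode_vector_def mode_config_def frame_vector_def assms complex_eq_iff)

end

text \<open>The sign pattern of the mode forms, from which the index follows by linear algebra
  alone; large A enters only through these assumptions. The bound on N keeps 1 and N - 1 distinct
  and the range 2, ..., N - 2 nonempty.\<close>

locale alternating_polygon = polygon +
  assumes N_ge_4: "N \<ge> 4"
    and mixed_0: "mixed_coeff N A 0 = 0" and tangential_0: "tangential_coeff N A 0 = 0"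
    and radial_0: "radial_coeff N A 0 > 0"
    and tangential_pos: "\<And>m. 1 \<le> m \<Longrightarrow> m < N \<Longrightarrow> tangential_coeff N A m > 0"
    and det_pos: "\<And>m. m = 1 \<or> m = N - 1 \<Longrightarrow> mode_det N A m > 0"
    and det_neg: "\<And>m. 2 \<le> m \<Longrightarrow> m \<le> N - 2 \<Longrightarrow> mode_det N A m < 0"
begin

abbreviation mode_form :: "nat \<Rightarrow> real \<Rightarrow> real \<Rightarrow> real" where
  "mode_form m a b \<equiv>
     radial_coeff N A m * a\<^sup>2 + 2 * mixed_coeff N A m * a * b + tangential_coeff N A m * b\<^sup>2"

abbreviation hess_form :: "(nat \<Rightarrow> complex) \<Rightarrow> real" where
  "hess_form v \<equiv> hessian_quot N A (regular_polygon N A) v v"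

lemma hess_form_mode_vector: "hess_form (mode_vector a b) = real N * (\<Sum>m<N. mode_form m (a m) (b m))"
  by (rule hessian_quot_mode_vector)

lemma mode_form_pos:
  assumes "m < N" "a \<noteq> 0 \<or> b \<noteq> 0" "2 \<le> m \<and> m \<le> N - 2 \<Longrightarrow> a = 0" "m = 0 \<Longrightarrow> b = 0"
  shows "mode_form m a b > 0"
proof -
  consider "m = 0" | "m = 1 \<or> m = N - 1" | "2 \<le> m \<and> m \<le> N - 2"
    using assms(1) by linarith
  then show ?thesis
  proof cases
    case 1
    then show ?thesis using assms radial_0 by simp
  next
    case 2
    then have "1 \<le> m" using N_ge_4 by auto
    then show ?thesis
      using assms(1,2) det_pos[OF 2] tangential_pos[of m] by (intro quadratic_form_pos) auto
  next
    case 3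
    then show ?thesis using assms tangential_pos[of m] by simp
  qed
qed

text \<open>
  The radial amplitudes of the modes \<open>2, \<dots>, N - 2\<close> and the mean rotation are \<open>N - 2\<close> linear functionals
  on whose common kernel the Hessian is positive definite; hence they are jointly injective on every
  subspace that is negative definite modulo the rotations.
\<close>

lemma dim_negative_definite_le:
  assumes U: "subspace U" "U \<subseteq> configs N"
    and neg: "negative_definite_on N A (regular_polygon N A) U"
  shows "dim U \<le> N - 2"
proof -
  \<comment> \<open>Slot 0 holds the mean rotation and the other N - 3 slots hold radial amplitudes,
    so \<open>I\<close> has N - 2 elements.\<close>
  define I where "I = insert 0 {2..N - 2}"
  define f where "f v = (\<lambda>m. if m = 0 then tangential_mode v 0 else if m \<in> I then radial_mode v m else 0)" for v
  have "linear f"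
    by (rule linearI)
      (auto simp: f_def fun_eq_iff radial_mode_linear tangential_mode_linear scaleR_fun_apply)
  moreover have "v = 0" if "v \<in> U" "f v = 0" for v
  proof (rule ccontr)
    assume "v \<noteq> 0"
    define a where "a = radial_mode v"
    define b where "b = tangential_mode v"
    have v: "v = mode_vector a b"
      using mode_vector_modes[of v] that U by (auto simp: a_def b_def)
    have fv: "f v m = 0" for m
      unfolding that(2) by simp
    have "b 0 = 0"
      using fv[of 0] by (simp add: f_def b_def)
    moreover have "a m = 0" if "2 \<le> m \<and> m \<le> N - 2" for m
      using fv[of m] that by (auto simp: f_def I_def a_def)
    ultimately have ab: "b 0 = 0" "\<And>m. 2 \<le> m \<and> m \<le> N - 2 \<Longrightarrow> a m = 0"
      by blast+
    obtain n where n: "n < N" "a n \<noteq> 0 \<or> b n \<noteq> 0"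
      using \<open>v \<noteq> 0\<close> v mode_vector_zero[of a b] by metis
    have "mode_form m (a m) (b m) \<ge> 0" if "m < N" for m
    proof (cases "a m = 0 \<and> b m = 0")
      case False
      then show ?thesis using mode_form_pos[OF that, of "a m" "b m"] ab by force
    qed simp
    moreover have "mode_form n (a n) (b n) > 0"
      using mode_form_pos[OF n] ab by blast
    ultimately have "(\<Sum>m<N. mode_form m (a m) (b m)) > 0"
      using n(1) by (intro sum_pos2[where i = n]) auto
    then have "hess_form v > 0"
      using n(1) by (simp add: v hess_form_mode_vector)
    moreover have "v \<notin> orbit_tangent (regular_polygon N A)"
    proof
      assume "v \<in> orbit_tangent (regular_polygon N A)"
      then obtain c where "v = mode_vector (\<lambda>_. 0) (\<lambda>m. if m = 0 then c else 0)"
        by (auto simp: orbit_tangent_eq)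
      then have "hess_form v = real N * (\<Sum>m<N. mode_form m 0 (if m = 0 then c else 0))"
        by (simp only: hess_form_mode_vector)
      also have "(\<Sum>m<N. mode_form m 0 (if m = 0 then c else 0)) = 0"
        by (intro sum.neutral) (simp add: tangential_0)
      finally show False
        using \<open>hess_form v > 0\<close> by simp
    qed
    ultimately show False
      using neg \<open>v \<in> U\<close> by (force simp: negative_definite_on_def)
  qed
  moreover have "finite I"
    by (simp add: I_def)
  then have "f ` U \<subseteq> span (unit_vector ` I)"
    unfolding span_unit_vectors[OF \<open>finite I\<close>] by (auto simp: f_def I_def)
  ultimately have "dim U \<le> card (unit_vector ` I)"
    using dim_le_card_linear_inj[OF _ U(1), of f "unit_vector ` I"] \<open>finite I\<close> by blast
  also have "\<dots> = card I"
    by (intro card_image inj_on_subset[OF inj_unit_vector]) simp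
  also have "\<dots> = N - 2"
    using N_ge_4 by (simp add: I_def)
  finally show ?thesis .
qed

text \<open>
  On each mode \<open>2, \<dots>, N - 2\<close> the tangential amplitude is chosen to annihilate the completed square,
  which leaves the determinant of the form divided by its positive tangential coefficient.
\<close>

lemma negative_definite_witness:
  obtains U where "subspace U" "orbit_tangent (regular_polygon N A) \<subseteq> U" "U \<subseteq> configs N"
    "negative_definite_on N A (regular_polygon N A) U" "dim U = N - 2"
proof -
  define I where "I = insert 0 {2..N - 2}"
  define fa :: "(nat \<Rightarrow> real) \<Rightarrow> nat \<Rightarrow> real" where
    "fa c = (\<lambda>m. if 2 \<le> m \<and> m \<le> N - 2 then c m else 0)" for c
  define fb :: "(nat \<Rightarrow> real) \<Rightarrow> nat \<Rightarrow> real" where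
    "fb c = (\<lambda>m. if m = 0 then c 0 else if 2 \<le> m \<and> m \<le> N - 2
             then - (mixed_coeff N A m / tangential_coeff N A m) * c m else 0)" for c
  define f where "f c = mode_vector (fa c) (fb c)" for c
  have "linear f"
  proof (rule linearI)
    fix c d and k :: real
    have "fa (c + d) = fa c + fa d" "fb (c + d) = fb c + fb d"
      by (auto simp: fa_def fb_def fun_eq_iff algebra_simps add_divide_distrib)
    then show "f (c + d) = f c + f d"
      by (simp add: f_def mode_vector_add)
    have "fa (k *\<^sub>R c) = k *\<^sub>R fa c" "fb (k *\<^sub>R c) = k *\<^sub>R fb c"
      by (auto simp: fa_def fb_def fun_eq_iff scaleR_fun_def)
    then show "f (k *\<^sub>R c) = k *\<^sub>R f c"
      by (simp add: f_def mode_vector_scaleR)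
  qed
  define U where "U = f ` span (unit_vector ` I)"
  define D where "D m = mode_det N A m / tangential_coeff N A m" for m
  have D_neg: "D m < 0" if "2 \<le> m" "m \<le> N - 2" for m
    unfolding D_def using that N_ge_4 by (intro divide_neg_pos det_neg tangential_pos) auto
  have form: "mode_form m (fa c m) (fb c m) = (if 2 \<le> m \<and> m \<le> N - 2 then D m * (c m)\<^sup>2 else 0)"
    if "m < N" for m c
  proof (cases "2 \<le> m \<and> m \<le> N - 2")
    case True
    then have Q: "tangential_coeff N A m \<noteq> 0"
      using tangential_pos[of m] \<open>m < N\<close> by simp
    have "tangential_coeff N A m * fb c m + mixed_coeff N A m * fa c m = 0"
      using True Q by (simp add: fa_def fb_def)
    then show ?thesis
      unfolding quadratic_form_complete_square[OF Q] D_def using True by (simp add: fa_def)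
  next
    case False
    then have "fa c m = 0" "fb c m = 0 \<or> m = 0"
      by (auto simp: fa_def fb_def)
    then show ?thesis
      using False tangential_0 by (cases "m = 0") auto
  qed
  have neg: "hess_form (f c) < 0" if n: "2 \<le> n" "n \<le> N - 2" "c n \<noteq> 0" for c n
  proof -
    have "n < N"
      using n N_ge_4 by linarith
    define T where "T = (\<Sum>m<N. if 2 \<le> m \<and> m \<le> N - 2 then - D m * (c m)\<^sup>2 else 0)"
    have "(\<Sum>m<N. mode_form m (fa c m) (fb c m)) = - T"
      unfolding T_def sum_negf[symmetric] by (intro sum.cong refl) (simp add: form)
    moreover have "T > 0"
      unfolding T_def using n \<open>n < N\<close> D_neg
      by (intro sum_pos2[where i = n]) (auto simp: mult_neg_pos less_imp_le mult_nonpos_nonneg)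
    ultimately show ?thesis
      using N_ge_4 unfolding f_def hess_form_mode_vector by simp
  qed
  have rotation: "f c = mode_vector (\<lambda>_. 0) (\<lambda>m. if m = 0 then c 0 else 0)"
    if "\<And>n. 2 \<le> n \<Longrightarrow> n \<le> N - 2 \<Longrightarrow> c n = 0" for c
  proof -
    have "fa c = (\<lambda>_. 0)"
      unfolding fa_def by (rule ext) (simp add: that)
    moreover have "fb c = (\<lambda>m. if m = 0 then c 0 else 0)"
      unfolding fb_def by (rule ext) (simp add: that)
    ultimately show ?thesis
      by (simp add: f_def)
  qed
  \<comment> \<open>Injectivity comes from definiteness: \<open>f c = 0\<close> has zero Hessian,
    which excludes nonzero entries in the slots 2, ..., N - 2. What remains is a rotation, whose
    size is read off at body 0.\<close>
  have "c = 0" if supp: "\<And>m. m \<notin> I \<Longrightarrow> c m = 0" and "f c = 0" for c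
  proof -
    have "hess_form (f c) = 0"
      unfolding \<open>f c = 0\<close> using hess_form_mode_vector[of 0 0] by (simp add: mode_vector_zero)
    then have c0: "c n = 0" if "2 \<le> n" "n \<le> N - 2" for n
      using neg[OF that] by fastforce
    from fun_cong[OF rotation[of c, OF c0], of 0] have "c 0 = 0"
      using N_ge by (simp add: \<open>f c = 0\<close> mode_vector_rotation complex_eq_iff polygon_angles_def)
    have "c m = 0" for m
    proof (cases "m \<in> I")
      case True
      then show ?thesis
        using c0[of m] \<open>c 0 = 0\<close> by (auto simp: I_def)
    qed (rule supp)
    then show "c = 0"
      by (simp add: fun_eq_iff)
  qed
  moreover have "finite I"
    by (simp add: I_def)
  ultimately have "dim U = card I"
    unfolding U_def using dim_linear_image_unit_vectors[OF \<open>linear f\<close>, of I] by blast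
  then have "dim U = N - 2"
    using N_ge_4 by (simp add: I_def)
  moreover have "subspace U"
    unfolding U_def by (intro linear_subspace_image \<open>linear f\<close> subspace_span)
  moreover have "orbit_tangent (regular_polygon N A) \<subseteq> U"
  proof
    fix v assume "v \<in> orbit_tangent (regular_polygon N A)"
    then obtain c where "v = mode_vector (\<lambda>_. 0) (\<lambda>m. if m = 0 then c else 0)"
      by (auto simp: orbit_tangent_eq)
    then have "v = f (\<lambda>m. if m = 0 then c else 0)"
      by (subst rotation) simp_all
    then show "v \<in> U"
      unfolding U_def span_unit_vectors[OF \<open>finite I\<close>] by (auto simp: I_def)
  qed
  moreover have "U \<subseteq> configs N"
    by (auto simp: U_def f_def mode_vector_def configs_def)
  moreover have "negative_definite_on N A (regular_polygon N A) U"
    unfolding negative_definite_on_def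
  proof
    fix v assume v: "v \<in> U - orbit_tangent (regular_polygon N A)"
    then obtain c where c: "v = f c"
      by (auto simp: U_def)
    have "\<exists>n. 2 \<le> n \<and> n \<le> N - 2 \<and> c n \<noteq> 0"
      using v rotation[of c] unfolding c orbit_tangent_eq by blast
    then show "hess_form v < 0"
      unfolding c using neg by blast
  qed
  ultimately show ?thesis
    using that by blast
qed

text \<open>The admissible \<open>U\<close> contain the rotation line, so the extremal dimension N -
  2 drops by one in the quotient.\<close>

lemma morse_index_eq: "morse_index_quot N A (regular_polygon N A) = N - 3"
  unfolding morse_index_quot_def dim_orbit_tangent
proof (rule Max_eqI)
  show "finite {dim U - 1 |U. subspace U \<and> orbit_tangent (regular_polygon N A) \<subseteq> U \<and> U \<subseteq> configs N \<and>
      negative_definite_on N A (regular_polygon N A) U}" (is "finite ?S")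
    by (rule finite_subset[of _ "{..N}"]) (use dim_negative_definite_le in force)+
  show "n \<le> N - 3" if "n \<in> ?S" for n
    using that dim_negative_definite_le by force
  obtain U where "subspace U" "orbit_tangent (regular_polygon N A) \<subseteq> U" "U \<subseteq> configs N"
    "negative_definite_on N A (regular_polygon N A) U" "dim U = N - 2"
    by (rule negative_definite_witness)
  moreover have "N - 3 = N - 2 - 1"
    by simp
  ultimately show "N - 3 \<in> ?S"
    by (metis (mono_tags, lifting) mem_Collect_eq)
qed

end

subsection \<open>The Hessian in polar coordinates\<close>

definition single_body :: "nat \<Rightarrow> complex \<Rightarrow> nat \<Rightarrow> complex" where
  "single_body j \<omega> = (\<lambda>k. if k = j then \<omega> else 0)"

text \<open>Moving body 0 affects only the pairs containing it, and in the ordering i < k these are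
  exactly the pairs with i = 0.\<close>

lemma sum_row_zero:
  fixes f :: "nat \<Rightarrow> nat \<Rightarrow> 'a :: comm_monoid_add"
  assumes "\<And>i k. 0 < i \<Longrightarrow> i < k \<Longrightarrow> f i k = 0"
  shows "(\<Sum>k<N. \<Sum>i<k. f i k) = (\<Sum>k=1..<N. f 0 k)"
proof -
  have "(\<Sum>i<k. f i k) = (if k = 0 then 0 else f 0 k)" for k
  proof (cases "k = 0")
    case False
    then have "(\<Sum>i<k. f i k) = (\<Sum>i\<in>{0}. f i k)"
      using assms by (intro sum.mono_neutral_right) auto
    then show ?thesis using False by simp
  qed simp
  then have "(\<Sum>k<N. \<Sum>i<k. f i k) = (\<Sum>k<N. if k = 0 then 0 else f 0 k)"
    by simp
  also have "\<dots> = (\<Sum>k=1..<N. f 0 k)"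
    by (rule sum.mono_neutral_cong_right) auto
  finally show ?thesis .
qed

lemma sum_inner_single_body: "j < N \<Longrightarrow> (\<Sum>i<N. z i \<bullet> single_body j \<omega> i) = z j \<bullet> \<omega>"
proof -
  assume "j < N"
  have "(\<Sum>i<N. z i \<bullet> single_body j \<omega> i) = (\<Sum>i<N. if i = j then z j \<bullet> \<omega> else 0)"
    by (intro sum.cong) (auto simp: single_body_def)
  with \<open>j < N\<close> show ?thesis by simp
qed

text \<open>Only body 0 is treated as the first argument because \<open>circulant_eigenvalue\<close>
  reads nothing but row 0 of a matrix.\<close>

lemma energy_hess_single_body:
  assumes "N > 0"
  shows "energy_hess N A z (single_body 0 \<zeta>) v
    = real N * (\<zeta> \<bullet> v 0) + (\<Sum>k=1..<N. pair_hess A (z 0 - z k) \<zeta> (v 0 - v k))"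
proof -
  have "(\<Sum>k<N. \<Sum>i<k. pair_hess A (z i - z k) (single_body 0 \<zeta> i - single_body 0 \<zeta> k) (v i - v k))
     = (\<Sum>k=1..<N. pair_hess A (z 0 - z k) (single_body 0 \<zeta> 0 - single_body 0 \<zeta> k) (v 0 - v k))"
    by (rule sum_row_zero) (simp add: single_body_def pair_hess_def)
  also have "\<dots> = (\<Sum>k=1..<N. pair_hess A (z 0 - z k) \<zeta> (v 0 - v k))"
    by (intro sum.cong) (auto simp: single_body_def)
  finally show ?thesis
    using sum_inner_single_body[OF assms, of v \<zeta>]
    by (simp add: energy_hess_def inner_commute)
qed

lemma energy_grad_single_body:
  assumes "N > 0"
  shows "energy_grad N A z (single_body 0 \<omega>)
    = real N * (z 0 \<bullet> \<omega>) - (\<Sum>k=1..<N. norm (z 0 - z k) powr (- A) * ((z 0 - z k) \<bullet> \<omega>))"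
proof -
  have "(\<Sum>k<N. \<Sum>i<k. norm (z i - z k) powr (- A) * ((z i - z k) \<bullet> (single_body 0 \<omega> i - single_body 0 \<omega> k)))
     = (\<Sum>k=1..<N. norm (z 0 - z k) powr (- A) * ((z 0 - z k) \<bullet> (single_body 0 \<omega> 0 - single_body 0 \<omega> k)))"
    by (rule sum_row_zero) (simp add: single_body_def)
  also have "\<dots> = (\<Sum>k=1..<N. norm (z 0 - z k) powr (- A) * ((z 0 - z k) \<bullet> \<omega>))"
    by (intro sum.cong) (auto simp: single_body_def)
  finally show ?thesis
    by (simp add: energy_grad_def sum_inner_single_body[OF assms])
qed

lemma energy_grad_zero: "energy_grad N A z (\<lambda>_. 0) = 0"
  by (simp add: energy_grad_def)

lemma single_body_zero: "single_body j 0 = (\<lambda>_. 0)"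
  by (auto simp: single_body_def)

section \<open>First derivatives of the energy in polar coordinates\<close>

lemma rcis_has_vector_derivative: "(rcis r has_vector_derivative \<i> * rcis r x) (at x)"
proof -
  have "((\<lambda>x. Complex (r * cos x) (r * sin x)) has_vector_derivative Complex (- r * sin x) (r * cos x)) (at x)"
    by (auto simp: has_vector_derivative_complex_iff intro!: derivative_eq_intros)
  moreover have "(\<lambda>x. Complex (r * cos x) (r * sin x)) = rcis r"
    "Complex (- r * sin x) (r * cos x) = \<i> * rcis r x"
    by (auto simp: complex_eq_iff)
  ultimately show ?thesis by simp
qed

lemma from_polar_has_derivative_radius:
  assumes "i < N"
  shows "((\<lambda>x. from_polar N (r(j := x)) \<theta> i) has_vector_derivative single_body j (cis (\<theta> j)) i) (at x)"
proof (cases "i = j")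
  case True
  have "((\<lambda>x. x *\<^sub>R cis (\<theta> j)) has_vector_derivative cis (\<theta> j)) (at x)"
    by (auto intro!: derivative_eq_intros)
  then show ?thesis
    using True assms by (simp add: from_polar_def single_body_def rcis_def scaleR_conv_of_real)
qed (use assms in \<open>simp add: from_polar_def single_body_def\<close>)

lemma from_polar_has_derivative_angle:
  assumes "i < N"
  shows "((\<lambda>x. from_polar N r (\<theta>(j := x)) i) has_vector_derivative single_body j (\<i> * rcis (r j) x) i) (at x)"
proof (cases "i = j")
  case True
  then show ?thesis
    using rcis_has_vector_derivative[of "r j" x] assms by (simp add: from_polar_def single_body_def)
qed (use assms in \<open>simp add: from_polar_def single_body_def\<close>)

lemma partial_r_energy_polar:
  assumes "A > 2" "collision_free N (from_polar N r \<theta>)"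
  shows "partial_r j (energy_polar N A) r \<theta>
    = energy_grad N A (from_polar N r \<theta>) (single_body j (cis (\<theta> j)))"
  using energy_has_derivative[where z = "\<lambda>x. from_polar N (r(j := x)) \<theta>" and x = "r j",
      OF assms(1) from_polar_has_derivative_radius] assms(2)
  by (auto simp: partial_r_def energy_polar_def intro: DERIV_imp_deriv)

lemma partial_\<theta>_energy_polar:
  assumes "A > 2" "collision_free N (from_polar N r \<theta>)"
  shows "partial_\<theta> j (energy_polar N A) r \<theta>
    = energy_grad N A (from_polar N r \<theta>) (single_body j (\<i> * rcis (r j) (\<theta> j)))"
  using energy_has_derivative[where z = "\<lambda>x. from_polar N r (\<theta>(j := x))" and x = "\<theta> j",
      OF assms(1) from_polar_has_derivative_angle] assms(2)
  by (auto simp: partial_\<theta>_def energy_polar_def intro: DERIV_imp_deriv)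

lemma single_body_has_vector_derivative:
  assumes "(f has_vector_derivative f') F"
  shows "((\<lambda>x. single_body j (f x) i) has_vector_derivative single_body j f' i) F"
  using assms by (cases "i = j") (simp_all add: single_body_def)

text \<open>Pairs \<open>j\<close> with N - j. This mirror symmetry of the polygon yields the
  tangential force balance and makes the circulant sums purely real or purely imaginary.\<close>

lemma sum_reflect_zero:
  fixes f :: "nat \<Rightarrow> real"
  assumes "f 0 = 0" and refl: "\<And>j. 0 < j \<Longrightarrow> j < N \<Longrightarrow> f (N - j) = - f j"
  shows "(\<Sum>j<N. f j) = 0"
proof -
  have "(\<Sum>j<N. f j) = (\<Sum>j\<in>{0<..<N}. f j)"
    using assms(1) by (intro sum.mono_neutral_right) auto
  also have "\<dots> = (\<Sum>j\<in>{0<..<N}. f (N - j))"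
    by (rule sum.reindex_bij_witness[where i = "\<lambda>j. N - j" and j = "\<lambda>j. N - j"]) auto
  also have "\<dots> = - (\<Sum>j\<in>{0<..<N}. f j)"
    by (simp add: refl sum_negf)
  also have "(\<Sum>j\<in>{0<..<N}. f j) = (\<Sum>j<N. f j)"
    using assms(1) by (intro sum.mono_neutral_left) auto
  finally show ?thesis by simp
qed

lemma sin_cos_reflect:
  assumes "0 < j" "j < N"
  shows "sin (pi * real (N - j) / real N) = sin (pi * real j / real N)"
    and "cos (pi * real (N - j) / real N) = - cos (pi * real j / real N)"
    and "sin (2 * (pi * real m * real (N - j) / real N)) = - sin (2 * (pi * real m * real j / real N))"
    and "cos (2 * (pi * real m * real (N - j) / real N)) = cos (2 * (pi * real m * real j / real N))"
proof -
  have e1: "pi * real (N - j) / real N = pi - pi * real j / real N"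
    using assms by (simp add: of_nat_diff field_simps)
  have e2: "2 * (pi * real m * real (N - j) / real N) = 2 * pi * real m - 2 * (pi * real m * real j / real N)"
    using assms by (simp add: of_nat_diff field_simps)
  show "sin (pi * real (N - j) / real N) = sin (pi * real j / real N)"
    "cos (pi * real (N - j) / real N) = - cos (pi * real j / real N)"
    unfolding e1 by simp_all
  have "sin (2 * pi * real m) = 0" "cos (2 * pi * real m) = 1"
    using sin_2npi[of m] cos_2npi[of m] by (simp_all add: mult_ac)
  then show "sin (2 * (pi * real m * real (N - j) / real N)) = - sin (2 * (pi * real m * real j / real N))"
    "cos (2 * (pi * real m * real (N - j) / real N)) = cos (2 * (pi * real m * real j / real N))"
    unfolding e2 sin_diff cos_diff by simp_all
qed

text \<open>The self-interaction \<open>c\<close> sits at phase 0 and therefore enters the real part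
  only.\<close>

lemma circulant_eigenvalue_eq:
  assumes "\<And>j. j < N \<Longrightarrow> M 0 j = (if j = 0 then c else 0) + g j" and "N > 0"
  shows "circulant_eigenvalue N M m =
    Complex (c + (\<Sum>j<N. g j * cos (2 * (pi * real m * real j / real N))))
            (\<Sum>j<N. g j * sin (2 * (pi * real m * real j / real N)))"
proof -
  have "exp (2 * of_real pi * \<i> * of_nat m * of_nat j / of_nat N) = cis (2 * (pi * real m * real j / real N))" for j
    by (simp add: cis_conv_exp mult_ac)
  then have "circulant_eigenvalue N M m
      = (\<Sum>j<N. complex_of_real ((if j = 0 then c else 0) + g j) * cis (2 * (pi * real m * real j / real N)))"
    by (simp add: circulant_eigenvalue_def assms(1))
  moreover have "(\<Sum>j<N. ((if j = 0 then c else 0) + g j) * cos (2 * (pi * real m * real j / real N)))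
      = (\<Sum>j<N. if j = 0 then c else 0) + (\<Sum>j<N. g j * cos (2 * (pi * real m * real j / real N)))"
    unfolding sum.distrib[symmetric] by (intro sum.cong) (auto simp: algebra_simps)
  moreover have "(\<Sum>j<N. ((if j = 0 then c else 0) + g j) * sin (2 * (pi * real m * real j / real N)))
      = (\<Sum>j<N. g j * sin (2 * (pi * real m * real j / real N)))"
    by (intro sum.cong) auto
  ultimately show ?thesis
    using \<open>N > 0\<close> by (simp add: complex_eq_iff)
qed

section \<open>The polar Hessian blocks of the polygon and their eigenvalues\<close>

context polygon
begin

lemma N_pos: "N > 0"
  using N_ge by simp

lemma bond_0: "bond 0 = 0"
  by (simp add: bond_weight_def)

lemma bond_reflect: "0 < j \<Longrightarrow> j < N \<Longrightarrow> bond (N - j) = bond j"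
  by (simp only: bond_weight_def sin_cos_reflect(1))

lemma bond_nonneg: "bond j \<ge> 0"
  by (simp add: bond_weight_def)

lemma sum_bond_sin_cos: "(\<Sum>j<N. bond j * (sin (pi * real j / real N) * cos (pi * real j / real N))) = 0"
proof (rule sum_reflect_zero)
  show "bond (N - j) * (sin (pi * real (N - j) / real N) * cos (pi * real (N - j) / real N))
      = - (bond j * (sin (pi * real j / real N) * cos (pi * real j / real N)))" if "0 < j" "j < N" for j
    unfolding bond_reflect[OF that] sin_cos_reflect[OF that] by simp
qed simp

text \<open>The radial force balance at a vertex. It is the definition of the radius with the outer
  power 1 / A removed and the exponent 2 - A split into the weight and a squared sine.\<close>

lemma sum_bond_sin_sq: "2 * (\<Sum>j<N. bond j * (sin (pi * real j / real N))\<^sup>2) = real N"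
proof -
  define u where "u j = 2 * sin (pi * real j / real N)" for j
  define S where "S = (\<Sum>j=1..<N. u j powr (2 - A))"
  have u: "u j > 0" if "0 < j" "j < N" for j
    using sin_chord_pos[OF that] by (simp add: u_def)
  have "S > 0"
    unfolding S_def using N_ge by (intro sum_pos) (use u in \<open>simp_all add: powr_gt_zero less_imp_neq[symmetric]\<close>)
  have \<rho>: "\<rho> = (S / (2 * real N)) powr (1 / A)"
    by (simp add: polygon_radius_def S_def u_def)
  have "\<rho> powr A = S / (2 * real N)"
    unfolding \<rho> powr_powr using A_gt \<open>S > 0\<close> N_pos by simp
  then have "S = 2 * real N * \<rho> powr A"
    using N_pos by simp
  then have \<rho>A: "\<rho> powr (- A) * S = 2 * real N"
    using \<rho>_pos by (simp add: powr_minus)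
  have "4 * (\<Sum>j<N. bond j * (sin (pi * real j / real N))\<^sup>2) = (\<Sum>j<N. bond j * (u j)\<^sup>2)"
    by (simp add: u_def sum_distrib_left power_mult_distrib mult_ac)
  also have "\<dots> = (\<Sum>j=1..<N. bond j * (u j)\<^sup>2)"
    by (intro sum.mono_neutral_right) (auto simp: bond_0 not_less_eq_eq less_Suc_eq_0_disj)
  also have "\<dots> = (\<Sum>j=1..<N. \<rho> powr (- A) * u j powr (2 - A))"
  proof (intro sum.cong refl)
    fix j assume "j \<in> {1..<N}"
    then have "u j > 0" using u by simp
    then have "u j powr (- A) * (u j)\<^sup>2 = u j powr (2 - A)"
      by (simp flip: powr_numeral powr_add)
    then show "bond j * (u j)\<^sup>2 = \<rho> powr (- A) * u j powr (2 - A)"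
      using \<rho>_pos \<open>u j > 0\<close> by (simp add: bond_weight_def powr_mult flip: u_def)
  qed
  also have "\<dots> = 2 * real N"
    unfolding sum_distrib_left[symmetric] S_def[symmetric] by (rule \<rho>A)
  finally show ?thesis by simp
qed

lemma polygon_point_0: "polygon_point N A 0 = of_real \<rho>"
  by (simp add: polygon_point_def polygon_angles_def rcis_def)

lemma polygon_angles_0: "polygon_angles N 0 = 0"
  by (simp add: polygon_angles_def)

lemma sum_from_1_bond:
  assumes "f 0 = 0"
  shows "(\<Sum>k=1..<N. f k) = (\<Sum>k<N. f k :: real)"
  using assms by (intro sum.mono_neutral_left) (auto simp: not_less_eq_eq less_Suc_eq_0_disj)

text \<open>Criticality in the position of body 0: the radial component cancels by the choice of
  radius, the tangential one by reflection.\<close>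

lemma energy_grad_polygon_point: "energy_grad N A (polygon_point N A) (single_body 0 \<omega>) = 0"
proof -
  have summand: "norm (polygon_point N A 0 - polygon_point N A k) powr (- A) * ((polygon_point N A 0 - polygon_point N A k) \<bullet> \<omega>)
     = 2 * \<rho> * Re \<omega> * (bond k * (sin (pi * real k / real N))\<^sup>2)
       - 2 * \<rho> * Im \<omega> * (bond k * (sin (pi * real k / real N) * cos (pi * real k / real N)))"
    if "k < N" for k
  proof -
    define d where "d = \<rho> * (2 * sin (pi * real k / real N))"
    have "d \<ge> 0"
      using \<rho>_pos sin_chord_nonneg[OF that] by (simp add: d_def)
    have diff: "polygon_point N A 0 - polygon_point N A k = cis (pi * real k / real N) * Complex 0 (- d)"
      using polygon_point_diff[of N A 0 k] by (simp add: d_def polygon_angles_0)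
    have norm: "norm (polygon_point N A 0 - polygon_point N A k) = d"
      using \<open>d \<ge> 0\<close> unfolding diff norm_mult norm_cis by (simp add: cmod_def)
    have inner: "(polygon_point N A 0 - polygon_point N A k) \<bullet> \<omega>
        = d * (sin (pi * real k / real N) * Re \<omega> - cos (pi * real k / real N) * Im \<omega>)"
      unfolding diff by (simp add: inner_complex_def algebra_simps)
    have "d powr (- A) = bond k"
      by (simp add: bond_weight_def d_def)
    then show ?thesis
      unfolding norm inner by (simp add: d_def power2_eq_square algebra_simps)
  qed
  have "(\<Sum>k=1..<N. norm (polygon_point N A 0 - polygon_point N A k) powr (- A) * ((polygon_point N A 0 - polygon_point N A k) \<bullet> \<omega>))
      = 2 * \<rho> * Re \<omega> * (\<Sum>k<N. bond k * (sin (pi * real k / real N))\<^sup>2)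
       - 2 * \<rho> * Im \<omega> * (\<Sum>k<N. bond k * (sin (pi * real k / real N) * cos (pi * real k / real N)))"
    by (subst sum_from_1_bond) (simp_all add: summand sum_subtractf flip: sum_distrib_left)
  also have "\<dots> = \<rho> * Re \<omega> * (2 * (\<Sum>k<N. bond k * (sin (pi * real k / real N))\<^sup>2))"
    by (simp add: sum_bond_sin_cos)
  finally show ?thesis
    unfolding sum_bond_sin_sq energy_grad_single_body[OF N_pos]
    by (simp add: polygon_point_0 inner_complex_def)
qed

text \<open>\<open>\<zeta>\<close> is given in the midpoint frame of every bond, as body 0 meets all
  others; \<open>\<omega>\<close> is needed only in that of bond \<open>j\<close>. Since
  \<open>bond 0\<close> is zero, the last term may stay in the diagonal entry, so one formula covers
  the row.\<close>

lemma energy_hess_polygon_point_entry: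
  assumes "j < N"
    and \<zeta>: "\<And>k. \<zeta> = cis (pi * real k / real N) * Complex (a k) (b k)"
    and \<omega>: "\<omega> = cis (pi * real j / real N) * Complex a' b'"
  shows "energy_hess N A (polygon_point N A) (single_body 0 \<zeta>) (single_body j \<omega>)
    = (if j = 0 then real N * (\<zeta> \<bullet> \<omega>) + (\<Sum>k<N. pair_hess A (polygon_point N A 0 - polygon_point N A k) \<zeta> \<omega>)
       else 0) - bond j * ((A - 1) * (b j * b') - a j * a')"
proof (cases "j = 0")
  case True
  have "pair_hess A (polygon_point N A 0 - polygon_point N A 0) \<zeta> \<omega> = 0"
    by (simp add: pair_hess_def)
  then have "(\<Sum>k=1..<N. pair_hess A (polygon_point N A 0 - polygon_point N A k) \<zeta> \<omega>)
      = (\<Sum>k<N. pair_hess A (polygon_point N A 0 - polygon_point N A k) \<zeta> \<omega>)"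
    by (rule sum_from_1_bond)
  moreover have "(\<Sum>k=1..<N. pair_hess A (polygon_point N A 0 - polygon_point N A k) \<zeta>
        (single_body 0 \<omega> 0 - single_body 0 \<omega> k))
      = (\<Sum>k=1..<N. pair_hess A (polygon_point N A 0 - polygon_point N A k) \<zeta> \<omega>)"
    by (intro sum.cong) (auto simp: single_body_def)
  ultimately show ?thesis
    unfolding True energy_hess_single_body[OF N_pos] by (simp add: bond_0 single_body_def)
next
  case False
  have "(\<Sum>k=1..<N. pair_hess A (polygon_point N A 0 - polygon_point N A k) \<zeta>
        (single_body j \<omega> 0 - single_body j \<omega> k))
      = (\<Sum>k=1..<N. if k = j then - pair_hess A (polygon_point N A 0 - polygon_point N A j) \<zeta> \<omega> else 0)"
    using False by (intro sum.cong) (auto simp: single_body_def pair_hess_def)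
  also have "\<dots> = - pair_hess A (polygon_point N A 0 - polygon_point N A j) \<zeta> \<omega>"
    using False assms(1) by simp
  also have "pair_hess A (polygon_point N A 0 - polygon_point N A j) \<zeta> \<omega>
      = bond j * ((A - 1) * (b j * b') - a j * a')"
    using pair_hess_polygon_point[OF assms(1), of 0 "a j" "b j" a' b']
    unfolding \<omega> \<zeta>[of j] by (simp add: polygon_angles_0)
  finally show ?thesis
    using False unfolding energy_hess_single_body[OF N_pos] by (simp add: single_body_def)
qed

lemma frame_factor:
  "1 = cis (pi * real k / real N) * Complex (cos (pi * real k / real N)) (- sin (pi * real k / real N))"
  "\<i> = cis (pi * real k / real N) * Complex (sin (pi * real k / real N)) (cos (pi * real k / real N))"
  by (simp_all add: complex_eq_iff flip: power2_eq_square)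

lemma cis_polygon_angles_factor:
  "cis (polygon_angles N j)
   = cis (pi * real j / real N) * Complex (cos (pi * real j / real N)) (sin (pi * real j / real N))"
  using cis_polygon_angles_shift(2)[of N 0 j] by (simp add: polygon_angles_0 cis.ctr)

lemma ii_cis_polygon_angles_factor:
  "\<i> * cis (polygon_angles N j)
   = cis (pi * real j / real N) * Complex (- sin (pi * real j / real N)) (cos (pi * real j / real N))"
  unfolding cis_polygon_angles_factor by (simp add: complex_eq_iff)

lemma from_polar_polygon: "from_polar N (polygon_radii N A) (polygon_angles N) = regular_polygon N A"
  by (simp add: regular_polygon_def)

lemma energy_hess_regular_polygon:
  "energy_hess N A (regular_polygon N A) u v = energy_hess N A (polygon_point N A) u v"
  by (rule energy_hess_cong) (simp_all add: regular_polygon_eq_point)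

lemma energy_grad_regular_polygon: "energy_grad N A (regular_polygon N A) (single_body 0 \<omega>) = 0"
proof -
  have "energy_grad N A (regular_polygon N A) (single_body 0 \<omega>)
      = energy_grad N A (polygon_point N A) (single_body 0 \<omega>)"
    unfolding energy_grad_def
    by (intro arg_cong2[where f = "(-)"] arg_cong[where f = "times (real N)"] sum.cong refl)
      (auto simp: regular_polygon_eq_point)
  then show ?thesis by (simp add: energy_grad_polygon_point)
qed

lemma hess_R_eq:
  "hess_R N A 0 j = energy_hess N A (polygon_point N A) (single_body 0 1)
     (single_body j (cis (polygon_angles N j)))"
proof -
  have "hess_R N A 0 j = energy_hess N A (from_polar N ((polygon_radii N A)(0 := polygon_radii N A 0)) (polygon_angles N))
      (single_body 0 (cis (polygon_angles N 0))) (single_body j (cis (polygon_angles N j)))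
      + energy_grad N A (from_polar N ((polygon_radii N A)(0 := polygon_radii N A 0)) (polygon_angles N)) (\<lambda>_. 0)"
    unfolding hess_R_def partial_r_def[of 0]
    by (rule deriv_energy_grad_eq[OF from_polar_has_derivative_radius])
      (simp_all add: partial_r_energy_polar[OF A_gt] from_polar_polygon collision_free_regular_polygon)
  then show ?thesis
    by (simp add: from_polar_polygon energy_hess_regular_polygon energy_grad_zero polygon_angles_0)
qed

lemma hess_W_eq:
  "hess_W N A 0 j = energy_hess N A (polygon_point N A) (single_body 0 1)
     (single_body j (\<rho> *\<^sub>R (\<i> * cis (polygon_angles N j))))"
proof -
  \<comment> \<open>The rate at which the angular direction of body \<open>j\<close> changes with
    the radius of body 0. It is nonzero only for \<open>j = 0\<close>, and criticality then removes
    its contribution.\<close>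
  define w where "w = single_body j (if j = 0 then \<i> else 0)"
  have v: "((\<lambda>x. single_body j (\<i> * rcis (((polygon_radii N A)(0 := x)) j) (polygon_angles N j)) i)
      has_vector_derivative w i) (at y)" for i y
    unfolding w_def
  proof (rule single_body_has_vector_derivative)
    have "((\<lambda>x. x *\<^sub>R \<i>) has_vector_derivative \<i>) (at y)"
      by (auto intro!: derivative_eq_intros)
    then show "((\<lambda>x. \<i> * rcis (((polygon_radii N A)(0 := x)) j) (polygon_angles N j))
        has_vector_derivative (if j = 0 then \<i> else 0)) (at y)"
      by (cases "j = 0") (simp_all add: rcis_def polygon_angles_0 scaleR_conv_of_real mult_ac)
  qed
  have "hess_W N A 0 j = energy_hess N A (from_polar N ((polygon_radii N A)(0 := polygon_radii N A 0)) (polygon_angles N))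
      (single_body 0 (cis (polygon_angles N 0)))
      (single_body j (\<i> * rcis (((polygon_radii N A)(0 := polygon_radii N A 0)) j) (polygon_angles N j)))
      + energy_grad N A (from_polar N ((polygon_radii N A)(0 := polygon_radii N A 0)) (polygon_angles N)) w"
    unfolding hess_W_def partial_r_def[of 0]
    by (rule deriv_energy_grad_eq[OF from_polar_has_derivative_radius v])
      (simp_all add: partial_\<theta>_energy_polar[OF A_gt] from_polar_polygon collision_free_regular_polygon)
  moreover have "energy_grad N A (regular_polygon N A) w = 0"
    by (cases "j = 0") (simp_all add: w_def single_body_zero energy_grad_zero energy_grad_regular_polygon)
  ultimately show ?thesis
    unfolding fun_upd_triv from_polar_polygon energy_hess_regular_polygon
    by (simp add: polygon_angles_0 polygon_radii_def rcis_def scaleR_conv_of_real mult_ac)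
qed

lemma hess_T_eq:
  "hess_T N A 0 j = energy_hess N A (polygon_point N A) (single_body 0 (\<rho> *\<^sub>R \<i>))
     (single_body j (\<rho> *\<^sub>R (\<i> * cis (polygon_angles N j))))"
proof -
  \<comment> \<open>The centripetal acceleration of body 0 on its circle, again removed by
    criticality.\<close>
  define w where "w y = single_body j (if j = 0 then \<i> * (\<i> * rcis \<rho> y) else 0)" for y
  have v: "((\<lambda>x. single_body j (\<i> * rcis (polygon_radii N A j) (((polygon_angles N)(0 := x)) j)) i)
      has_vector_derivative w y i) (at y)" for i y
    unfolding w_def
  proof (rule single_body_has_vector_derivative)
    show "((\<lambda>x. \<i> * rcis (polygon_radii N A j) (((polygon_angles N)(0 := x)) j))
        has_vector_derivative (if j = 0 then \<i> * (\<i> * rcis \<rho> y) else 0)) (at y)"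
      using has_vector_derivative_mult_right[OF rcis_has_vector_derivative[of \<rho> y], of \<i>]
      by (cases "j = 0") (simp_all add: polygon_radii_def)
  qed
  have "hess_T N A 0 j = energy_hess N A (from_polar N (polygon_radii N A) ((polygon_angles N)(0 := polygon_angles N 0)))
      (single_body 0 (\<i> * rcis (polygon_radii N A 0) (polygon_angles N 0)))
      (single_body j (\<i> * rcis (polygon_radii N A j) (((polygon_angles N)(0 := polygon_angles N 0)) j)))
      + energy_grad N A (from_polar N (polygon_radii N A) ((polygon_angles N)(0 := polygon_angles N 0)))
          (w (polygon_angles N 0))"
    unfolding hess_T_def partial_\<theta>_def[of 0]
    by (rule deriv_energy_grad_eq[OF from_polar_has_derivative_angle v])
      (simp_all add: partial_\<theta>_energy_polar[OF A_gt] from_polar_polygon collision_free_regular_polygon)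
  moreover have "energy_grad N A (regular_polygon N A) (w (polygon_angles N 0)) = 0"
    by (cases "j = 0") (simp_all add: w_def single_body_zero energy_grad_zero energy_grad_regular_polygon)
  ultimately show ?thesis
    unfolding fun_upd_triv from_polar_polygon energy_hess_regular_polygon
    by (simp add: polygon_angles_0 polygon_radii_def rcis_def scaleR_conv_of_real mult_ac)
qed

abbreviation (input) "sb j \<equiv> sin (pi * real j / real N)"
abbreviation (input) "cb j \<equiv> cos (pi * real j / real N)"

lemma pair_hess_scaleR: "pair_hess A d (s *\<^sub>R u) (t *\<^sub>R v) = s * t * pair_hess A d u v"
  by (simp add: pair_hess_def algebra_simps)

lemma energy_hess_scaleR:
  "energy_hess N A z (single_body i (s *\<^sub>R u)) (single_body j (t *\<^sub>R v))
   = s * t * energy_hess N A z (single_body i u) (single_body j v)"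
proof -
  have "single_body i (s *\<^sub>R u) k = s *\<^sub>R single_body i u k" for i s u k
    by (simp add: single_body_def)
  then show ?thesis
    by (simp add: energy_hess_def pair_hess_scaleR distrib_left sum_distrib_left mult_ac
        flip: scaleR_diff_right)
qed

lemma pair_hess_polygon_point_0:
  assumes "k < N" "\<zeta> = cis (pi * real k / real N) * Complex a b"
    "\<omega> = cis (pi * real k / real N) * Complex a' b'"
  shows "pair_hess A (polygon_point N A 0 - polygon_point N A k) \<zeta> \<omega> = bond k * ((A - 1) * (b * b') - a * a')"
  using pair_hess_polygon_point[OF assms(1), of 0] unfolding assms(2,3) by (simp add: polygon_angles_0)

lemma hess_R_row:
  assumes "j < N"
  shows "hess_R N A 0 j
    = (if j = 0 then real N + (\<Sum>k<N. bond k * ((A - 1) * (sb k)\<^sup>2 - (cb k)\<^sup>2)) else 0)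
      + bond j * ((A - 1) * (sb j)\<^sup>2 + (cb j)\<^sup>2)"
  unfolding hess_R_eq
    energy_hess_polygon_point_entry[OF assms frame_factor(1) cis_polygon_angles_factor]
  by (auto simp: polygon_angles_0 pair_hess_polygon_point_0[OF _ frame_factor(1) frame_factor(1)]
      power2_eq_square algebra_simps)

lemma hess_W_row:
  assumes "j < N"
  shows "hess_W N A 0 j = \<rho> * (A - 2) * (bond j * (sb j * cb j))"
proof -
  have "hess_W N A 0 j = \<rho> * energy_hess N A (polygon_point N A) (single_body 0 1)
     (single_body j (\<i> * cis (polygon_angles N j)))"
    using energy_hess_scaleR[of _ 0 1 1 j \<rho>] by (simp add: hess_W_eq)
  also have "energy_hess N A (polygon_point N A) (single_body 0 1)
     (single_body j (\<i> * cis (polygon_angles N j)))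
     = (if j = 0 then - A * (\<Sum>k<N. bond k * (sb k * cb k)) else 0) + (A - 2) * (bond j * (sb j * cb j))"
    unfolding energy_hess_polygon_point_entry[OF assms frame_factor(1) ii_cis_polygon_angles_factor]
      sum_distrib_left
    by (auto simp: polygon_angles_0 pair_hess_polygon_point_0[OF _ frame_factor(1) frame_factor(2)]
      inner_complex_def algebra_simps intro!: sum.cong)
  finally show ?thesis
    by (simp add: sum_bond_sin_cos)
qed

lemma hess_T_row:
  assumes "j < N"
  shows "hess_T N A 0 j
    = (if j = 0 then \<rho>\<^sup>2 * (real N + (\<Sum>k<N. bond k * ((A - 1) * (cb k)\<^sup>2 - (sb k)\<^sup>2))) else 0)
      + - \<rho>\<^sup>2 * (bond j * ((A - 1) * (cb j)\<^sup>2 + (sb j)\<^sup>2))"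
proof -
  have entry: "energy_hess N A (polygon_point N A) (single_body 0 \<i>)
     (single_body j (\<i> * cis (polygon_angles N j)))
     = (if j = 0 then real N + (\<Sum>k<N. bond k * ((A - 1) * (cb k)\<^sup>2 - (sb k)\<^sup>2)) else 0)
      + - (bond j * ((A - 1) * (cb j)\<^sup>2 + (sb j)\<^sup>2))"
    unfolding energy_hess_polygon_point_entry[OF assms frame_factor(2) ii_cis_polygon_angles_factor]
    by (auto simp: polygon_angles_0 pair_hess_polygon_point_0[OF _ frame_factor(2) frame_factor(2)]
      power2_eq_square algebra_simps)
  show ?thesis
    unfolding hess_T_eq energy_hess_scaleR entry
    by (cases "j = 0") (simp_all add: bond_0 power2_eq_square algebra_simps)
qed

lemma sum_bond_reflect_zero:
  assumes "\<And>j. 0 < j \<Longrightarrow> j < N \<Longrightarrow> f (N - j) = - f j"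
  shows "(\<Sum>j<N. bond j * f j) = 0"
  by (rule sum_reflect_zero) (simp_all add: bond_0 bond_reflect assms)

text \<open>Diagonal and off-diagonal parts of a circulant sum combine to 1 + cos 2x, 1 - cos 2x and
  sin 2x. The half angle recovers the squares and products in the coefficients of the Hartley
  modes.\<close>

lemma double_angle:
  fixes R w s c x :: real
  shows "w * ((A - 1) * s\<^sup>2 - c\<^sup>2) + w * ((A - 1) * s\<^sup>2 + c\<^sup>2) * cos (2 * x)
      = 2 * (w * ((A - 1) * (s * cos x)\<^sup>2 - (c * sin x)\<^sup>2))"
    and "R * (w * ((A - 1) * c\<^sup>2 - s\<^sup>2)) + - R * (w * ((A - 1) * c\<^sup>2 + s\<^sup>2)) * cos (2 * x)
      = R * (2 * (w * ((A - 1) * (c * sin x)\<^sup>2 - (s * cos x)\<^sup>2)))"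
    and "R * (A - 2) * (w * (s * c)) * sin (2 * x)
      = - R * (- 2 * (A - 2) * (w * (s * c * (sin x * cos x))))"
  unfolding cos_double_cos sin_double power_mult_distrib sin_squared_eq by (simp_all add: algebra_simps)

lemma P_diag_eq: "P_diag N A m = of_real (radial_coeff N A m)"
proof -
  define g where "g j = bond j * ((A - 1) * (sb j)\<^sup>2 + (cb j)\<^sup>2)" for j
  have "P_diag N A m = Complex
      ((real N + (\<Sum>k<N. bond k * ((A - 1) * (sb k)\<^sup>2 - (cb k)\<^sup>2)))
        + (\<Sum>j<N. g j * cos (2 * (pi * real m * real j / real N))))
      (\<Sum>j<N. g j * sin (2 * (pi * real m * real j / real N)))"
    unfolding P_diag_def
    by (rule circulant_eigenvalue_eq[OF _ N_pos]) (simp add: hess_R_row g_def)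
  also have "(\<Sum>j<N. g j * sin (2 * (pi * real m * real j / real N))) = 0"
  proof -
    have "(\<Sum>j<N. bond j * (((A - 1) * (sb j)\<^sup>2 + (cb j)\<^sup>2) * sin (2 * (pi * real m * real j / real N)))) = 0"
      by (rule sum_bond_reflect_zero) (simp only: sin_cos_reflect power2_minus mult_minus_right)
    then show ?thesis
      unfolding g_def by (simp only: mult.assoc)
  qed
  also have "(real N + (\<Sum>k<N. bond k * ((A - 1) * (sb k)\<^sup>2 - (cb k)\<^sup>2)))
        + (\<Sum>j<N. g j * cos (2 * (pi * real m * real j / real N))) = radial_coeff N A m"
    unfolding radial_coeff_def add.assoc sum.distrib[symmetric] sum_distrib_left g_def
    by (intro arg_cong2[where f = "(+)"] sum.cong refl double_angle(1))
  finally show ?thesis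
    by (simp add: complex_eq_iff)
qed

text \<open>An angular derivative moves a body with speed \<open>\<rho>\<close>, and two of them
  give the factor \<open>\<rho>\<^sup>2\<close>.\<close>

lemma Q_diag_eq: "Q_diag N A m = of_real (\<rho>\<^sup>2 * tangential_coeff N A m)"
proof -
  define g where "g j = - \<rho>\<^sup>2 * (bond j * ((A - 1) * (cb j)\<^sup>2 + (sb j)\<^sup>2))" for j
  have "Q_diag N A m = Complex
      (\<rho>\<^sup>2 * (real N + (\<Sum>k<N. bond k * ((A - 1) * (cb k)\<^sup>2 - (sb k)\<^sup>2)))
        + (\<Sum>j<N. g j * cos (2 * (pi * real m * real j / real N))))
      (\<Sum>j<N. g j * sin (2 * (pi * real m * real j / real N)))"
    unfolding Q_diag_def
    by (rule circulant_eigenvalue_eq[OF _ N_pos]) (simp add: hess_T_row g_def)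
  also have "(\<Sum>j<N. g j * sin (2 * (pi * real m * real j / real N))) = 0"
  proof -
    have "(\<Sum>j<N. bond j * (((A - 1) * (cb j)\<^sup>2 + (sb j)\<^sup>2) * sin (2 * (pi * real m * real j / real N)))) = 0"
      by (rule sum_bond_reflect_zero) (simp only: sin_cos_reflect power2_minus mult_minus_right)
    then show ?thesis
      unfolding g_def mult.assoc sum_distrib_left[symmetric] by simp
  qed
  also have "\<rho>\<^sup>2 * (real N + (\<Sum>k<N. bond k * ((A - 1) * (cb k)\<^sup>2 - (sb k)\<^sup>2)))
        + (\<Sum>j<N. g j * cos (2 * (pi * real m * real j / real N))) = \<rho>\<^sup>2 * tangential_coeff N A m"
    unfolding tangential_coeff_def distrib_left[where a = "\<rho>\<^sup>2"] add.assoc sum_distrib_left sum.distrib[symmetric] g_def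
    by (intro arg_cong2[where f = "(+)"] sum.cong refl double_angle(2))
  finally show ?thesis
    by (simp add: complex_eq_iff)
qed

lemma S_diag_eq: "S_diag N A m = \<i> * of_real (- \<rho> * mixed_coeff N A m)"
proof -
  define g where "g j = \<rho> * (A - 2) * (bond j * (sb j * cb j))" for j
  have "S_diag N A m = Complex (0 + (\<Sum>j<N. g j * cos (2 * (pi * real m * real j / real N))))
      (\<Sum>j<N. g j * sin (2 * (pi * real m * real j / real N)))"
    unfolding S_diag_def
    by (rule circulant_eigenvalue_eq[OF _ N_pos]) (simp add: hess_W_row g_def)
  also have "(\<Sum>j<N. g j * cos (2 * (pi * real m * real j / real N))) = 0"
  proof -
    have "(\<Sum>j<N. bond j * (sb j * cb j * cos (2 * (pi * real m * real j / real N)))) = 0"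
      by (rule sum_bond_reflect_zero) (simp only: sin_cos_reflect mult_minus_right mult_minus_left)
    then have "\<rho> * (A - 2) * (\<Sum>j<N. bond j * (sb j * cb j * cos (2 * (pi * real m * real j / real N)))) = 0"
      by simp
    then show ?thesis
      unfolding g_def sum_distrib_left by (simp only: mult.assoc)
  qed
  also have "(\<Sum>j<N. g j * sin (2 * (pi * real m * real j / real N))) = - \<rho> * mixed_coeff N A m"
    unfolding mixed_coeff_def sum_distrib_left g_def
    by (intro sum.cong refl double_angle(3))
  finally show ?thesis
    by (simp add: complex_eq_iff)
qed

text \<open>\<open>X m\<close> is the trace of the 2 x 2 block and \<open>\<rho>\<^sup>2\<close>
  times \<open>mode_det\<close> its determinant. The radicand is also a sum of two real squares, so
  \<open>csqrt\<close> reduces to \<open>sqrt\<close>.\<close>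

lemma eigenvalues_eq:
  defines "X \<equiv> \<lambda>m. radial_coeff N A m + \<rho>\<^sup>2 * tangential_coeff N A m"
  shows "eigenvalue_plus N A m = of_real ((X m + sqrt ((X m)\<^sup>2 - 4 * \<rho>\<^sup>2 * mode_det N A m)) / 2)"
    and "eigenvalue_minus N A m = of_real ((X m - sqrt ((X m)\<^sup>2 - 4 * \<rho>\<^sup>2 * mode_det N A m)) / 2)"
proof -
  have sq: "(P_diag N A m - Q_diag N A m)\<^sup>2 - 4 * (S_diag N A m)\<^sup>2
      = of_real ((X m)\<^sup>2 - 4 * \<rho>\<^sup>2 * mode_det N A m)"
    unfolding P_diag_eq Q_diag_eq S_diag_eq X_def power_mult_distrib
    by (simp add: power2_eq_square algebra_simps)
  have "(X m)\<^sup>2 - 4 * \<rho>\<^sup>2 * mode_det N A m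
      = (radial_coeff N A m - \<rho>\<^sup>2 * tangential_coeff N A m)\<^sup>2 + (2 * \<rho> * mixed_coeff N A m)\<^sup>2"
    by (simp add: X_def power2_eq_square algebra_simps)
  then have "(X m)\<^sup>2 - 4 * \<rho>\<^sup>2 * mode_det N A m \<ge> 0"
    by simp
  then have root: "csqrt (of_real ((X m)\<^sup>2 - 4 * \<rho>\<^sup>2 * mode_det N A m))
      = of_real (sqrt ((X m)\<^sup>2 - 4 * \<rho>\<^sup>2 * mode_det N A m))"
    by (rule csqrt_of_real)
  show "eigenvalue_plus N A m = of_real ((X m + sqrt ((X m)\<^sup>2 - 4 * \<rho>\<^sup>2 * mode_det N A m)) / 2)"
    "eigenvalue_minus N A m = of_real ((X m - sqrt ((X m)\<^sup>2 - 4 * \<rho>\<^sup>2 * mode_det N A m)) / 2)"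
    unfolding eigenvalue_plus_def eigenvalue_minus_def sq root
    by (simp_all add: P_diag_eq Q_diag_eq X_def)
qed

lemma eigenvalues_det_neg:
  assumes "mode_det N A m < 0"
  shows "real_positive (eigenvalue_plus N A m)" "real_negative (eigenvalue_minus N A m)"
proof -
  define X where "X = radial_coeff N A m + \<rho>\<^sup>2 * tangential_coeff N A m"
  have "\<rho>\<^sup>2 * mode_det N A m < 0"
    using assms \<rho>_pos by (simp add: mult_pos_neg)
  then have "\<bar>X\<bar> < sqrt (X\<^sup>2 - 4 * \<rho>\<^sup>2 * mode_det N A m)"
    by (intro real_less_rsqrt) simp
  then show "real_positive (eigenvalue_plus N A m)" "real_negative (eigenvalue_minus N A m)"
    unfolding real_positive_def real_negative_def eigenvalues_eq X_def by simp_all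
qed

lemma eigenvalues_det_pos:
  assumes "mode_det N A m > 0" "tangential_coeff N A m > 0"
  shows "real_positive (eigenvalue_plus N A m)" "real_positive (eigenvalue_minus N A m)"
proof -
  define X where "X = radial_coeff N A m + \<rho>\<^sup>2 * tangential_coeff N A m"
  have "radial_coeff N A m * tangential_coeff N A m > 0"
    using assms(1) zero_le_power2[of "mixed_coeff N A m"] by linarith
  then have "radial_coeff N A m > 0"
    using assms(2) by (simp add: zero_less_mult_iff)
  then have "X > 0"
    using assms(2) \<rho>_pos by (simp add: X_def add_pos_pos)
  have "\<rho>\<^sup>2 * mode_det N A m > 0"
    using assms(1) \<rho>_pos by simp
  define R where "R = sqrt (X\<^sup>2 - 4 * \<rho>\<^sup>2 * mode_det N A m)"
  have "R < X"
    unfolding R_def using \<open>X > 0\<close> \<open>\<rho>\<^sup>2 * mode_det N A m > 0\<close> by (intro real_less_lsqrt) simp_all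
  moreover have "R \<ge> 0"
  proof -
    have "X\<^sup>2 - 4 * \<rho>\<^sup>2 * mode_det N A m
      = (radial_coeff N A m - \<rho>\<^sup>2 * tangential_coeff N A m)\<^sup>2 + (2 * \<rho> * mixed_coeff N A m)\<^sup>2"
      by (simp add: X_def power2_eq_square algebra_simps)
    then show ?thesis by (simp add: R_def)
  qed
  ultimately have "(X + R) / 2 > 0" "(X - R) / 2 > 0"
    using \<open>X > 0\<close> by simp_all
  then show "real_positive (eigenvalue_plus N A m)" "real_positive (eigenvalue_minus N A m)"
    unfolding real_positive_def eigenvalues_eq X_def R_def by simp_all
qed

lemma mixed_coeff_0: "mixed_coeff N A 0 = 0"
  by (simp add: mixed_coeff_def)

lemma tangential_coeff_0: "tangential_coeff N A 0 = 0"
  using sum_bond_sin_sq by (simp add: tangential_coeff_def sum_negf)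

lemma radial_coeff_0: "radial_coeff N A 0 > 0"
proof -
  have "radial_coeff N A 0 = real N + (A - 1) * (2 * (\<Sum>j<N. bond j * (sb j)\<^sup>2))"
    by (simp add: radial_coeff_def sum_distrib_left mult_ac)
  then show ?thesis
    using N_pos A_gt by (simp add: sum_bond_sin_sq add_pos_pos)
qed

text \<open>Radial balance replaces the harmonic term N by a bond sum. It absorbs the negative terms
  through 1 - cos^2 = sin^2, leaving nonnegative summands of which the one for \<open>j = 1\<close>
  is positive.\<close>

lemma tangential_coeff_pos:
  assumes "1 \<le> m" "m < N"
  shows "tangential_coeff N A m > 0"
proof -
  define f where "f j = bond j * ((A - 1) * (cb j * sin (pi * real m * real j / real N))\<^sup>2
      + (sb j * sin (pi * real m * real j / real N))\<^sup>2)" for j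
  have "tangential_coeff N A m = 2 * (\<Sum>j<N. bond j * (sb j)\<^sup>2) + 2 * (\<Sum>j<N. bond j *
     ((A - 1) * (cb j * sin (pi * real m * real j / real N))\<^sup>2
      - (sb j * cos (pi * real m * real j / real N))\<^sup>2))"
    by (simp add: tangential_coeff_def sum_bond_sin_sq)
  also have "\<dots> = 2 * (\<Sum>j<N. f j)"
    unfolding distrib_left[symmetric] sum.distrib[symmetric] f_def
    by (intro arg_cong[where f = "times 2"] sum.cong refl)
      (simp add: power_mult_distrib cos_squared_eq algebra_simps)
  finally have eq: "tangential_coeff N A m = 2 * (\<Sum>j<N. f j)" .
  have "f j \<ge> 0" for j
    unfolding f_def using bond_nonneg A_gt by (intro mult_nonneg_nonneg add_nonneg_nonneg) auto
  moreover have "f 1 > 0"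
  proof -
    have "bond 1 > 0"
      using \<rho>_pos sin_chord_pos[of 1 N] N_ge by (simp add: bond_weight_def)
    moreover have "(sb 1 * sin (pi * real m * real 1 / real N))\<^sup>2 > 0"
      using sin_chord_pos[of 1 N] sin_chord_pos[of m N] assms by simp
    ultimately show ?thesis
      unfolding f_def using A_gt by (intro mult_pos_pos add_nonneg_pos mult_nonneg_nonneg) auto
  qed
  ultimately have "(\<Sum>j<N. f j) > 0"
    using N_ge by (intro sum_pos2[where i = 1]) auto
  then show ?thesis
    by (simp add: eq)
qed

end

subsection \<open>Large exponents\<close>

lemma sin_less_sin:
  assumes "0 \<le> y" "y < x" "x < pi - y"
  shows "sin y < sin x"
proof -
  have "sin x - sin y = 2 * sin ((x - y) / 2) * cos ((x + y) / 2)"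
    by (rule sin_diff_sin)
  moreover have "sin ((x - y) / 2) > 0"
    using assms by (intro sin_gt_zero) auto
  moreover have "cos ((x + y) / 2) > 0"
    using assms by (intro cos_gt_zero) auto
  ultimately show ?thesis
    by (smt (verit) mult_pos_pos)
qed

text \<open>For \<open>l = 1\<close> this compares sides with diagonals and puts their quotient
  below 1, the source of all exponential decay.\<close>

lemma sin_chord_less:
  assumes "l < j" "j < N - l"
  shows "sin (pi * real l / real N) < sin (pi * real j / real N)"
proof (rule sin_less_sin)
  have "N > 0" "real j < real N - real l"
    using assms by linarith+
  then have "pi * real j / real N < pi * (real N - real l) / real N"
    by (intro divide_strict_right_mono mult_strict_left_mono) auto
  also have "\<dots> = pi - pi * real l / real N"
    using \<open>N > 0\<close> by (simp add: field_simps)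
  finally show "pi * real j / real N < pi - pi * real l / real N" .
  show "pi * real l / real N < pi * real j / real N"
    using assms \<open>N > 0\<close> by (intro divide_strict_right_mono mult_strict_left_mono) auto
qed simp

lemma sin_chord_le:
  assumes "l \<le> j" "j \<le> N - l" "l \<le> N"
  shows "sin (pi * real l / real N) \<le> sin (pi * real j / real N)"
proof -
  consider "j = l" | "l < j" "j < N - l" | "j = N - l" "l < j"
    using assms by linarith
  then show ?thesis
  proof cases
    case 2
    then show ?thesis using sin_chord_less by (simp add: less_imp_le)
  next
    case 3
    show ?thesis
    proof (cases "l = 0")
      case False
      then show ?thesis
        using 3 sin_cos_reflect(1)[of l N] by simp
    qed (use 3 in simp)
  qed simp
qed

section \<open>Limits of the bond weights and mode determinants\<close>

lemma powr_tendsto_0: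
  fixes q :: real
  assumes "0 < q" "q < 1"
  shows "((\<lambda>A. q powr A) \<longlongrightarrow> 0) at_top" "((\<lambda>A. A * q powr A) \<longlongrightarrow> 0) at_top"
  using assms by real_asymp+

text \<open>
  The terms quadratic in \<open>A\<close> cancel because \<open>x\<^sup>2 = p q\<close>.
\<close>

lemma mode_det_limit:
  fixes G e1 e2 e3 :: "real \<Rightarrow> real" and n p q x g :: real
  assumes lim: "(G \<longlongrightarrow> g) at_top" "(e1 \<longlongrightarrow> 0) at_top" "(e2 \<longlongrightarrow> 0) at_top" "(e3 \<longlongrightarrow> 0) at_top"
    and x: "x\<^sup>2 = p * q"
  shows "((\<lambda>A. ((n + 4 * G A * ((A - 1) * p - q) + e1 A) * (n + 4 * G A * ((A - 1) * q - p) + e2 A)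
      - (- 4 * G A * (A - 2) * x + e3 A)\<^sup>2) / A)
    \<longlongrightarrow> 4 * g * n * (p + q) - 16 * g\<^sup>2 * (p - q)\<^sup>2) at_top"
proof -
  \<comment> \<open>The quotient by A as a polynomial in h = 1 / A and the remainders, so that the
    limit is plain continuity at h = 0. Each remainder has bounded coefficients, hence it need only
    tend to 0.\<close>
  define E where "E h G e1 e2 e3 = n\<^sup>2 * h + 4 * G * n * (p + q) * (1 - 2 * h) - 16 * G\<^sup>2 * (p - q)\<^sup>2 * (1 - h)
      + e1 * (n * h + 4 * G * ((1 - h) * q - h * p)) + e2 * (n * h + 4 * G * ((1 - h) * p - h * q))
      + e1 * e2 * h + 8 * e3 * G * (1 - 2 * h) * x - e3\<^sup>2 * h" for h G e1 e2 e3 :: real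
  have "((\<lambda>A. E (inverse A) (G A) (e1 A) (e2 A) (e3 A)) \<longlongrightarrow> E 0 g 0 0 0) at_top"
    unfolding E_def by (intro tendsto_intros lim tendsto_inverse_0_at_top filterlim_ident)
  moreover have "\<forall>\<^sub>F A in at_top. E (inverse A) (G A) (e1 A) (e2 A) (e3 A)
      = ((n + 4 * G A * ((A - 1) * p - q) + e1 A) * (n + 4 * G A * ((A - 1) * q - p) + e2 A)
      - (- 4 * G A * (A - 2) * x + e3 A)\<^sup>2) / A"
    using eventually_gt_at_top[of 0]
  proof eventually_elim
    case (elim A)
    have "E (inverse A) (G A) (e1 A) (e2 A) (e3 A) * A
      = n\<^sup>2 + 4 * G A * n * (p + q) * (A - 2) - 16 * (G A)\<^sup>2 * (p - q)\<^sup>2 * (A - 1)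
      + e1 A * (n + 4 * G A * ((A - 1) * q - p)) + e2 A * (n + 4 * G A * ((A - 1) * p - q))
      + e1 A * e2 A + 8 * e3 A * G A * (A - 2) * x - (e3 A)\<^sup>2"
      using elim by (simp add: E_def field_simps)
    also have "\<dots> = (n + 4 * G A * ((A - 1) * p - q) + e1 A) * (n + 4 * G A * ((A - 1) * q - p) + e2 A)
      - (- 4 * G A * (A - 2) * x + e3 A)\<^sup>2 + 16 * (G A)\<^sup>2 * (A - 2)\<^sup>2 * (x\<^sup>2 - p * q)"
      by algebra
    finally show ?case
      using elim x by (simp add: field_simps)
  qed
  ultimately show ?thesis
    by (rule Lim_transform_eventually[THEN tendsto_eq_rhs]) (simp add: E_def)
qed

text \<open>Separates the two neighbours of a vertex, \<open>j = 1\<close> and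
  \<open>j = N - 1\<close>, from its diagonals.\<close>

lemma sum_split_ends:
  fixes f :: "nat \<Rightarrow> real"
  assumes "N \<ge> 3" "f 0 = 0" "f (N - 1) = f 1"
  shows "(\<Sum>j<N. f j) = 2 * f 1 + (\<Sum>j=2..N - 2. f j)"
proof -
  have "{..<N} = {0, 1, N - 1} \<union> {2..N - 2}"
    using assms(1) by auto
  moreover have "(\<Sum>j\<in>{0, 1, N - 1} \<union> {2..N - 2}. f j) = (\<Sum>j\<in>{0, 1, N - 1}. f j) + (\<Sum>j=2..N - 2. f j)"
    using assms(1) by (intro sum.union_disjoint) auto
  ultimately show ?thesis
    using assms by simp
qed

context
  fixes N :: nat
  assumes N_ge_5: "N \<ge> 5"
begin

text \<open>The radius cancels in the ratio to the weight of a side, leaving a pure power of a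
  quotient of chords.\<close>

lemma bond_weight_quotient:
  assumes "A > 2" "0 < j" "j < N"
  shows "bond_weight N A j = bond_weight N A 1 * (sin (pi * real 1 / real N) / sin (pi * real j / real N)) powr A"
proof -
  have pos: "polygon_radius N A > 0" "sin (pi * real 1 / real N) > 0" "sin (pi * real j / real N) > 0"
    using N_ge_5 assms polygon_radius_pos[of N A] sin_chord_pos[of 1 N] sin_chord_pos[of j N] by simp_all
  then show ?thesis
    unfolding bond_weight_def by (simp add: powr_mult powr_divide powr_minus field_simps)
qed

lemma chord_quotient_powr_tendsto:
  assumes "2 \<le> j" "j \<le> N - 2"
  shows "((\<lambda>A. (sin (pi * real 1 / real N) / sin (pi * real j / real N)) powr A) \<longlongrightarrow> 0) at_top"
    and "((\<lambda>A. A * (sin (pi * real 1 / real N) / sin (pi * real j / real N)) powr A) \<longlongrightarrow> 0) at_top"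
proof -
  have "sin (pi * real 1 / real N) > 0" "sin (pi * real 1 / real N) < sin (pi * real j / real N)"
    using N_ge_5 assms sin_chord_pos[of 1 N] sin_chord_less[of 1 j N] by simp_all
  then show "((\<lambda>A. (sin (pi * real 1 / real N) / sin (pi * real j / real N)) powr A) \<longlongrightarrow> 0) at_top"
    "((\<lambda>A. A * (sin (pi * real 1 / real N) / sin (pi * real j / real N)) powr A) \<longlongrightarrow> 0) at_top"
    by (intro powr_tendsto_0; simp)+
qed

text \<open>Radial balance, with the weight of a side factored out, reads
  \<open>bond_weight N A 1 * w A = real N / 2\<close>, and \<open>w A\<close> tends to 2 b. The
  limit is thus found without any asymptotics of the radius itself.\<close>

lemma bond_weight_1_tendsto:
  "((\<lambda>A. bond_weight N A 1) \<longlongrightarrow> real N / (4 * (sin (pi * real 1 / real N))\<^sup>2)) at_top"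
proof -
  define b where "b = (sin (pi * real 1 / real N))\<^sup>2"
  define w where "w A = 2 * b + (\<Sum>j=2..N - 2. (sin (pi * real 1 / real N) / sin (pi * real j / real N)) powr A
      * (sin (pi * real j / real N))\<^sup>2)" for A
  have "b > 0"
    using sin_chord_pos[of 1 N] N_ge_5 by (simp add: b_def)
  have eq: "bond_weight N A 1 * w A = real N / 2" if "A > 2" for A
  proof -
    interpret polygon N A
      using that N_ge_5 by unfold_locales auto
    have "real N / 2 = (\<Sum>j<N. bond j * (sin (pi * real j / real N))\<^sup>2)"
      using sum_bond_sin_sq by simp
    also have "\<dots> = 2 * (bond 1 * b) + (\<Sum>j=2..N - 2. bond j * (sin (pi * real j / real N))\<^sup>2)"
      unfolding b_def
      using N_ge_5 bond_reflect[of 1] sin_cos_reflect(1)[of 1 N] by (intro sum_split_ends) (simp_all add: bond_0)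
    also have "(\<Sum>j=2..N - 2. bond j * (sin (pi * real j / real N))\<^sup>2)
        = (\<Sum>j=2..N - 2. bond 1 * ((sin (pi * real 1 / real N) / sin (pi * real j / real N)) powr A
            * (sin (pi * real j / real N))\<^sup>2))"
      using that by (intro sum.cong refl) (subst bond_weight_quotient, auto)
    finally show ?thesis
      by (simp add: w_def distrib_left sum_distrib_left)
  qed
  have "(w \<longlongrightarrow> 2 * b + (\<Sum>j=2..N - 2. 0 * (sin (pi * real j / real N))\<^sup>2)) at_top"
    unfolding w_def by (intro tendsto_intros chord_quotient_powr_tendsto) auto
  then have "((\<lambda>A. real N / 2 / w A) \<longlongrightarrow> real N / 2 / (2 * b)) at_top"
    using \<open>b > 0\<close> by (intro tendsto_divide) auto
  moreover have "\<forall>\<^sub>F A in at_top. real N / 2 / w A = bond_weight N A 1"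
    using eventually_gt_at_top[of 2]
  proof eventually_elim
    case (elim A)
    have "w A \<noteq> 0"
      using eq[OF elim] N_ge_5 by auto
    then show ?case
      by (simp only: eq[OF elim, symmetric]) simp
  qed
  ultimately show ?thesis
    unfolding b_def[symmetric] by (rule Lim_transform_eventually[THEN tendsto_eq_rhs]) simp
qed

text \<open>Exponential decay outweighs the linear growth of the coefficients in A; the shift
  \<open>k\<close> accommodates both A - 1 and A - 2.\<close>

lemma bond_weight_tendsto:
  assumes "2 \<le> j" "j \<le> N - 2"
  shows "((\<lambda>A. bond_weight N A j * ((A + k) * \<alpha> - \<beta>)) \<longlongrightarrow> 0) at_top"
proof -
  define q where "q = sin (pi * real 1 / real N) / sin (pi * real j / real N)"
  note lim = chord_quotient_powr_tendsto[OF assms, folded q_def]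
  have "((\<lambda>A. bond_weight N A 1 * ((A * q powr A) * \<alpha> + q powr A * (k * \<alpha> - \<beta>)))
      \<longlongrightarrow> real N / (4 * (sin (pi * real 1 / real N))\<^sup>2) * (0 * \<alpha> + 0 * (k * \<alpha> - \<beta>))) at_top"
    by (intro tendsto_intros bond_weight_1_tendsto lim)
  moreover have "\<forall>\<^sub>F A in at_top. bond_weight N A 1 * ((A * q powr A) * \<alpha> + q powr A * (k * \<alpha> - \<beta>))
      = bond_weight N A j * ((A + k) * \<alpha> - \<beta>)"
    using eventually_gt_at_top[of 2]
  proof eventually_elim
    case (elim A)
    then show ?case
      using assms N_ge_5 by (subst bond_weight_quotient[of A j]) (auto simp: q_def algebra_simps)
  qed
  ultimately show ?thesis
    by (rule Lim_transform_eventually[THEN tendsto_eq_rhs]) simp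
qed

lemma sum_bond_weight_tendsto:
  "((\<lambda>A. \<Sum>j=2..N - 2. bond_weight N A j * ((A + k) * \<alpha> j - \<beta> j)) \<longlongrightarrow> 0) at_top"
proof -
  have "((\<lambda>A. \<Sum>j=2..N - 2. bond_weight N A j * ((A + k) * \<alpha> j - \<beta> j)) \<longlongrightarrow> (\<Sum>j=2..N - 2. 0)) at_top"
    by (intro tendsto_sum bond_weight_tendsto) auto
  then show ?thesis by simp
qed

lemma mode_det_tendsto:
  fixes m :: nat
  defines "b \<equiv> (sin (pi * real 1 / real N))\<^sup>2" and "s \<equiv> (sin (pi * real m / real N))\<^sup>2"
  shows "((\<lambda>A. mode_det N A m / A) \<longlongrightarrow> (real N / b)\<^sup>2 * (s * (3 * b - 2 * b\<^sup>2 - s))) at_top"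
proof -
  define sb where "sb j = sin (pi * real j / real N)" for j
  define cb where "cb j = cos (pi * real j / real N)" for j
  define sm where "sm j = sin (pi * real m * real j / real N)" for j
  define cm where "cm j = cos (pi * real m * real j / real N)" for j
  define p where "p = (sb 1 * cm 1)\<^sup>2"
  define q where "q = (cb 1 * sm 1)\<^sup>2"
  define x where "x = sb 1 * cb 1 * (sm 1 * cm 1)"
  define e1 where "e1 A = 2 * (\<Sum>j=2..N - 2. bond_weight N A j * ((A + - 1) * (sb j * cm j)\<^sup>2 - (cb j * sm j)\<^sup>2))" for A
  define e2 where "e2 A = 2 * (\<Sum>j=2..N - 2. bond_weight N A j * ((A + - 1) * (cb j * sm j)\<^sup>2 - (sb j * cm j)\<^sup>2))" for A
  define e3 where "e3 A = - 2 * (\<Sum>j=2..N - 2. bond_weight N A j * ((A + - 2) * (sb j * cb j * (sm j * cm j)) - 0))" for A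
  have lim_e: "(e1 \<longlongrightarrow> 2 * 0) at_top" "(e2 \<longlongrightarrow> 2 * 0) at_top" "(e3 \<longlongrightarrow> - 2 * 0) at_top"
    unfolding e1_def e2_def e3_def by (intro tendsto_mult tendsto_const sum_bond_weight_tendsto)+
  have "x\<^sup>2 = p * q"
    by (simp add: x_def p_def q_def power_mult_distrib)
  note lim = mode_det_limit[OF bond_weight_1_tendsto lim_e[simplified] this, of "real N"]
  have "b > 0"
    using sin_chord_pos[of 1 N] N_ge_5 by (simp add: b_def)
  have reflect: "sb (N - 1) = sb 1" "cb (N - 1) = - cb 1"
    using sin_cos_reflect(1,2)[of 1 N] N_ge_5 unfolding sb_def cb_def by simp_all
  \<comment> \<open>Passing to the other neighbour multiplies the mode factors by signs (-1)^m.
    These square away, and the remaining sign of the product is undone by that of \<open>cb\<close>,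
    so both neighbours contribute equally.\<close>
  have "pi * real m * real (N - 1) / real N = real m * pi - pi * real m * real 1 / real N"
    using N_ge_5 by (simp add: of_nat_diff field_simps)
  then have sm: "sm (N - 1) = - cos (real m * pi) * sm 1" and cm: "cm (N - 1) = cos (real m * pi) * cm 1"
    by (simp_all add: sm_def cm_def sin_diff cos_diff)
  have "cos (real m * pi) * cos (real m * pi) = 1"
    using sin_cos_squared_add[of "real m * pi"] by (simp add: power2_eq_square)
  then have reflect': "(sm (N - 1))\<^sup>2 = (sm 1)\<^sup>2" "(cm (N - 1))\<^sup>2 = (cm 1)\<^sup>2"
    "sm (N - 1) * cm (N - 1) = - (sm 1 * cm 1)"
    unfolding sm cm by (simp_all add: power2_eq_square mult.assoc mult.left_commute)
  have "\<forall>\<^sub>F A in at_top. ((real N + 4 * bond_weight N A 1 * ((A - 1) * p - q) + e1 A)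
        * (real N + 4 * bond_weight N A 1 * ((A - 1) * q - p) + e2 A)
      - (- 4 * bond_weight N A 1 * (A - 2) * x + e3 A)\<^sup>2) / A = mode_det N A m / A"
    using eventually_gt_at_top[of 2]
  proof eventually_elim
    case (elim A)
    interpret polygon N A
      using elim N_ge_5 by unfold_locales auto
    have "bond (N - 1) = bond 1"
      using bond_reflect[of 1] N_ge_5 by simp
    note ends = reflect reflect' this power_mult_distrib power2_minus mult_minus_left mult_minus_right minus_minus
    have "(\<Sum>j<N. bond j * ((A - 1) * (sb j * cm j)\<^sup>2 - (cb j * sm j)\<^sup>2))
        = 2 * (bond 1 * ((A - 1) * p - q)) + (\<Sum>j=2..N - 2. bond j * ((A - 1) * (sb j * cm j)\<^sup>2 - (cb j * sm j)\<^sup>2))"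
      unfolding p_def q_def
      by (rule sum_split_ends) (use N_ge_5 in simp, simp add: bond_0, simp only: ends)
    then have P: "radial_coeff N A m = real N + 4 * bond 1 * ((A - 1) * p - q) + e1 A"
      unfolding radial_coeff_def e1_def sb_def[symmetric] cb_def[symmetric] sm_def[symmetric] cm_def[symmetric]
      by simp
    have "(\<Sum>j<N. bond j * ((A - 1) * (cb j * sm j)\<^sup>2 - (sb j * cm j)\<^sup>2))
        = 2 * (bond 1 * ((A - 1) * q - p)) + (\<Sum>j=2..N - 2. bond j * ((A - 1) * (cb j * sm j)\<^sup>2 - (sb j * cm j)\<^sup>2))"
      unfolding p_def q_def
      by (rule sum_split_ends) (use N_ge_5 in simp, simp add: bond_0, simp only: ends)
    then have Q: "tangential_coeff N A m = real N + 4 * bond 1 * ((A - 1) * q - p) + e2 A"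
      unfolding tangential_coeff_def e2_def sb_def[symmetric] cb_def[symmetric] sm_def[symmetric] cm_def[symmetric]
      by simp
    have "(\<Sum>j<N. bond j * (sb j * cb j * (sm j * cm j)))
        = 2 * (bond 1 * x) + (\<Sum>j=2..N - 2. bond j * (sb j * cb j * (sm j * cm j)))"
      unfolding x_def
      by (rule sum_split_ends) (use N_ge_5 in simp, simp add: bond_0, simp only: ends)
    moreover have "e3 A = - 2 * (A - 2) * (\<Sum>j=2..N - 2. bond j * (sb j * cb j * (sm j * cm j)))"
      unfolding e3_def sum_distrib_left by (intro sum.cong refl) (simp add: algebra_simps)
    ultimately have S: "mixed_coeff N A m = - 4 * bond 1 * (A - 2) * x + e3 A"
      unfolding mixed_coeff_def sb_def[symmetric] cb_def[symmetric] sm_def[symmetric] cm_def[symmetric]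
      by (simp add: algebra_simps)
    show ?case
      unfolding P Q S ..
  qed
  moreover have "4 * (real N / (4 * (sin (pi * real 1 / real N))\<^sup>2)) * real N * (p + q)
      - 16 * (real N / (4 * (sin (pi * real 1 / real N))\<^sup>2))\<^sup>2 * (p - q)\<^sup>2
      = (real N / b)\<^sup>2 * (s * (3 * b - 2 * b\<^sup>2 - s))"
  proof -
    \<comment> \<open>Here p + q = b + s - 2 b s and p - q = b - s; with the limiting weight N / (4
      b) the terms b^2 cancel and s factors out.\<close>
    have p: "p = b * (1 - s)" and q: "q = (1 - b) * s"
      by (simp_all add: p_def q_def b_def s_def sb_def cb_def sm_def cm_def power_mult_distrib cos_squared_eq)
    show ?thesis
      unfolding b_def[symmetric] p q using \<open>b > 0\<close> by (simp add: field_simps power2_eq_square)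
  qed
  ultimately show ?thesis
    by (rule tendsto_eq_rhs[OF Lim_transform_eventually[OF lim]])
qed

text \<open>At s = b the last factor of the limit is 2 b^2 (1 - b), positive because a side is not a
  diameter.\<close>

lemma eventually_mode_det_pos:
  assumes "m = 1 \<or> m = N - 1"
  shows "\<forall>\<^sub>F A in at_top. mode_det N A m > 0"
proof -
  define b where "b = (sin (pi * real 1 / real N))\<^sup>2"
  have "(sin (pi * real m / real N))\<^sup>2 = b"
    using assms sin_cos_reflect(1)[of 1 N] N_ge_5 by (auto simp: b_def)
  then have lim: "((\<lambda>A. mode_det N A m / A) \<longlongrightarrow> (real N / b)\<^sup>2 * (b * (3 * b - 2 * b\<^sup>2 - b))) at_top"
    using mode_det_tendsto[of m] by (simp add: b_def)
  have "sin (pi * real 1 / real N) > 0"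
    using N_ge_5 by (intro sin_chord_pos) auto
  moreover have "sin (pi * real 1 / real N) < 1"
    using sin_chord_less[of 1 2 N] N_ge_5 sin_le_one[of "pi * real 2 / real N"] by linarith
  ultimately have "0 < b" "b < 1"
    by (simp_all add: b_def power_less_one_iff)
  then have "b * (3 * b - 2 * b\<^sup>2 - b) > 0"
    by (simp add: power2_eq_square algebra_simps)
  then have "(real N / b)\<^sup>2 * (b * (3 * b - 2 * b\<^sup>2 - b)) > 0"
    using N_ge_5 \<open>0 < b\<close> by (intro mult_pos_pos[OF _ \<open>b * (3 * b - 2 * b\<^sup>2 - b) > 0\<close>]) simp
  from order_tendstoD(1)[OF lim this] eventually_gt_at_top[of 0] show ?thesis
    by eventually_elim (simp add: zero_less_divide_iff)
qed

lemma eventually_mode_det_neg: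
  assumes "2 \<le> m" "m \<le> N - 2"
  shows "\<forall>\<^sub>F A in at_top. mode_det N A m < 0"
proof -
  define b where "b = (sin (pi * real 1 / real N))\<^sup>2"
  define s where "s = (sin (pi * real m / real N))\<^sup>2"
  have lim: "((\<lambda>A. mode_det N A m / A) \<longlongrightarrow> (real N / b)\<^sup>2 * (s * (3 * b - 2 * b\<^sup>2 - s))) at_top"
    using mode_det_tendsto[of m] by (simp add: b_def s_def)
  have pos: "sin (pi * real 1 / real N) > 0" "sin (pi * real 2 / real N) > 0"
    using N_ge_5 by (intro sin_chord_pos; simp)+
  then have "b > 0"
    by (simp add: b_def)
  \<comment> \<open>The bound is sharp for this argument: N = 4 would give b = 1 / 2, s = 1 for m =
    2, and a vanishing limit.\<close>
  have "pi * real 1 / real N < pi / 4"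
    using N_ge_5 by (simp add: field_simps)
  then have "sin (pi * real 1 / real N) < sin (pi / 4)"
    using pi_gt_zero by (intro sin_less_sin; linarith?) simp
  then have "b < (sin (pi / 4))\<^sup>2"
    unfolding b_def using pos by (intro power_strict_mono) auto
  then have "b < 1 / 2"
    by (simp add: sin_45 power_divide)
  have "(sin (pi * real 2 / real N))\<^sup>2 \<le> s"
    unfolding s_def using pos sin_chord_le[of 2 m N] assms N_ge_5 by (intro power_mono) auto
  moreover have "(sin (pi * real 2 / real N))\<^sup>2 = 4 * b * (1 - b)"
  proof -
    have "pi * real 2 / real N = 2 * (pi * real 1 / real N)"
      by simp
    then show ?thesis
      unfolding b_def by (simp only: sin_double power_mult_distrib cos_squared_eq) simp
  qed
  moreover have "2 * b\<^sup>2 < b"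
    using \<open>b > 0\<close> \<open>b < 1 / 2\<close> by (simp add: power2_eq_square)
  ultimately have "3 * b - 2 * b\<^sup>2 - s < 0"
    by (simp add: power2_eq_square algebra_simps)
  moreover have "s > 0"
    using pos sin_chord_le[of 2 m N] assms N_ge_5 by (simp add: s_def)
  ultimately have "s * (3 * b - 2 * b\<^sup>2 - s) < 0"
    by (rule mult_pos_neg[rotated])
  then have "(real N / b)\<^sup>2 * (s * (3 * b - 2 * b\<^sup>2 - s)) < 0"
    using N_ge_5 \<open>0 < b\<close> by (intro mult_pos_neg[OF _ \<open>s * (3 * b - 2 * b\<^sup>2 - s) < 0\<close>]) simp
  from order_tendstoD(2)[OF lim this] eventually_gt_at_top[of 0] show ?thesis
    by eventually_elim (simp add: divide_less_0_iff)
qed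

text \<open>There are finitely many modes for fixed N, so their separate thresholds for A have a
  common one.\<close>

lemma eventually_alternating_polygon: "\<forall>\<^sub>F A in at_top. alternating_polygon N A"
proof -
  have "\<forall>\<^sub>F A in at_top. \<forall>m\<in>{1, N - 1}. mode_det N A m > 0"
    by (intro eventually_ball_finite ballI eventually_mode_det_pos) auto
  moreover have "\<forall>\<^sub>F A in at_top. \<forall>m\<in>{2..N - 2}. mode_det N A m < 0"
    by (intro eventually_ball_finite ballI eventually_mode_det_neg) auto
  ultimately show ?thesis
    using eventually_gt_at_top[of 2]
  proof eventually_elim
    case (elim A)
    interpret polygon N A
      using elim N_ge_5 by unfold_locales auto
    show ?case
      using elim N_ge_5 mixed_coeff_0 tangential_coeff_0 radial_coeff_0 tangential_coeff_pos
      by unfold_locales auto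
  qed
qed

end

theorem theorem4:
  fixes N :: nat
  assumes "N \<ge> 5"
  shows "\<exists>A\<^sub>N::real. \<forall>A::real. A > 2 \<and> A > A\<^sub>N \<longrightarrow>
           (\<forall>i\<in>{1..N div 2}.
              real_positive (eigenvalue_plus N A i) \<and>
              (i < 2 \<longrightarrow> real_positive (eigenvalue_minus N A i)) \<and>
              (i \<ge> 2 \<longrightarrow> real_negative (eigenvalue_minus N A i))) \<and>
           morse_index_quot N A (regular_polygon N A) = N - 3"
proof -
  obtain A\<^sub>N where A\<^sub>N: "alternating_polygon N A" if "A \<ge> A\<^sub>N" for A
    using eventually_alternating_polygon[OF assms] by (auto simp: eventually_at_top_linorder)
  show ?thesis
  proof (intro exI[of _ A\<^sub>N] allI impI conjI ballI)
    fix A i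
    assume "A > 2 \<and> A > A\<^sub>N"
    then interpret alternating_polygon N A
      using A\<^sub>N by simp
    show "morse_index_quot N A (regular_polygon N A) = N - 3"
      by (rule morse_index_eq)
    assume i: "i \<in> {1..N div 2}"
    show "real_positive (eigenvalue_minus N A i)" if "i < 2"
      using that i assms by (intro eigenvalues_det_pos det_pos tangential_pos) auto
    \<comment> \<open>The range of \<open>i\<close> stays among the negative modes, as N div 2 is at
      most N - 2.\<close>
    show "real_negative (eigenvalue_minus N A i)" if "i \<ge> 2"
      using that i assms by (intro eigenvalues_det_neg det_neg) auto
    show "real_positive (eigenvalue_plus N A i)"
    proof (cases "i < 2")
      case True
      then show ?thesis
        using i assms by (intro eigenvalues_det_pos det_pos tangential_pos) auto
    next
      case False
      then show ?thesis
        using i assms by (intro eigenvalues_det_neg det_neg) auto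
    qed
  qed
qed

end
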